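(* Let $m\ge 1$ and let $P$ be a poset on $\{1,2,\dots,m\}$. Suppose that $a_1\le a_2\le\dots\le a_m$ is the increasing rearrangement of $\overline{\mathrm{mc}}_P(1),\dots,\overline{\mathrm{mc}}_P(m)$. Then the Newton polygon of the numerator $N_P(q,x)$ of the $q$-Ehrhart polynomial of the order polytope $\mathcal{O}(P)$ is $$\mathrm{Newton}(N_P(q,x))=C(a_1,\dots,a_m;h)$$ for some integer $h\ge a_1+\dots+a_m$.
   Context: For $n\in\mathbb{Z}$, $[n]_q=\frac{1-q^n}{1-q}$. For a poset $P$ on $\{1,\dots,m\}$, the order polytope is $\mathcal{O}(P)=\{(x_1,\dots,x_m)\in[0,1]^m: x_i\le x_j \text{ if } i\le_P j\}$. For a polytope $M\subset\mathbb{R}^m$ and an integer $n\ge 0$, $nM=\{n\mathbf{x}:\mathbf{x}\in M\}$, and $W(M,q)=\sum_{\mathbf{x}\in M\cap\mathbb{Z}^m}q^{|\mathbf{x}|}$ with $|\mathbf{x}|=x_1+\dots+x_m$. The $q$-Ehrhart polynomial $E_P(x)\in\mathbb{Q}(q)[x]$ of $\mathcal{O}(P)$ is the (unique) polynomial in $x$ such that $E_P([n]_q)=W(n\mathcal{O}(P),q)$ for every integer $n\ge0$ (it exists by a theorem of Chapoton). The numerator $N_P(q,x)$ of $E_P(x)$ is the unique polynomial in $\mathbb{Z}[q,x]$ with positive leading coefficient such that $E_P(x)=N_P(q,x)/D(q)$ for some $D(q)\in\mathbb{Z}[q]$ with $\gcd(N_P(q,x),D(q))=1$ (in $\mathbb{Z}[q,x]$).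 For a polynomial $f(q,x)$, $\mathrm{Newton}(f(q,x))$ is the convex hull in $\mathbb{R}^2$ of the points $(i,j)$ such that the coefficient of $q^ix^j$ in $f$ is nonzero. For integers $1\le a_1\le\dots\le a_m$ and $h\ge a_1+\dots+a_m$, $C(a_1,\dots,a_m;h)$ is the convex hull in $\mathbb{R}^2$ of the points $(0,0)$, $(a_1+\dots+a_i,i)$ for $1\le i\le m$, $(h,m)$ and $(h-m,0)$. For $x\in P$, $\overline{\mathrm{mc}}_P(x)$ is the maximum size (number of elements) of a chain $\{t_1<_P\dots<_P t_k\}$ in $P$ starting at $x$, i.e. with $t_1=x$. *)

theory Defs
  imports
    "HOL-Analysis.Analysis"
    "HOL-Computational_Algebra.Polynomial_Factorial"
begin

text \<open>
  The field \<open>\<rat>(q)\<close> is \<^typ>\<open>rat poly fract\<close>, and \<open>\<int>[q,x]\<close> is \<^typ>\<open>int poly poly\<close>, with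
  \<open>x\<close> the outer and \<open>q\<close> the inner variable. A vector of \<open>\<real>\<^sup>m\<close> is a function
  \<^typ>\<open>nat \<Rightarrow> real\<close> with coordinates indexed by \<open>{1..m}\<close> and value \<open>0\<close> at all other indices,
  and a poset on \<open>{1..m}\<close> is a relation \<open>r\<close> with \<^prop>\<open>partial_order_on {1..m::nat} r\<close>, where
  \<open>(i, j) \<in> r\<close> means that \<open>i\<close> is less than or equal to \<open>j\<close>.
\<close>

definition qvar :: "rat poly fract" where
  "qvar = to_fract (monom 1 1)"

definition qint :: "int \<Rightarrow> rat poly fract" where
  "qint n = (1 - qvar powi n) / (1 - qvar)"

definition rn :: "nat \<Rightarrow> (nat \<Rightarrow> real) set" where
  "rn m = {x. \<forall>i. i \<notin> {1..m} \<longrightarrow> x i = 0}"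

definition zn :: "nat \<Rightarrow> (nat \<Rightarrow> real) set" where
  "zn m = {x \<in> rn m. \<forall>i\<in>{1..m}. x i \<in> \<int>}"

definition order_polytope :: "nat \<Rightarrow> (nat \<times> nat) set \<Rightarrow> (nat \<Rightarrow> real) set" where
  "order_polytope m r =
    {x \<in> rn m. (\<forall>i\<in>{1..m}. x i \<in> {0..1}) \<and> (\<forall>(i, j)\<in>r. x i \<le> x j)}"

definition dilate :: "nat \<Rightarrow> (nat \<Rightarrow> real) set \<Rightarrow> (nat \<Rightarrow> real) set" where
  "dilate n M = (\<lambda>x i. real n * x i) ` M"

text \<open>
  On lattice points the coordinate sum is an integer, so the floor below only changes its type.
\<close>

definition qweight :: "nat \<Rightarrow> (nat \<Rightarrow> real) set \<Rightarrow> rat poly fract" where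
  "qweight m M = (\<Sum>x \<in> M \<inter> zn m. qvar powi \<lfloor>\<Sum>i=1..m. x i\<rfloor>)"

definition q_ehrhart :: "nat \<Rightarrow> (nat \<times> nat) set \<Rightarrow> rat poly fract poly" where
  "q_ehrhart m r =
    (THE E. \<forall>n::nat. poly E (qint (int n)) = qweight m (dilate n (order_polytope m r)))"

definition of_int_poly_q :: "int poly \<Rightarrow> rat poly fract" where
  "of_int_poly_q p = to_fract (map_poly of_int p)"

text \<open>
  The sign of an element of \<open>\<int>[q,x]\<close> is that of the coefficient of its leading monomial for the
  lexicographic order with \<open>x > q\<close>.
\<close>

definition numerator :: "rat poly fract poly \<Rightarrow> int poly poly" where
  "numerator E =
    (THE N. lead_coeff (lead_coeff N) > 0 \<and>
      (\<exists>D. D \<noteq> 0 \<and> E = smult (1 / of_int_poly_q D) (map_poly of_int_poly_q N)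
           \<and> gcd N [:D:] = 1))"

definition newton :: "int poly poly \<Rightarrow> (real \<times> real) set" where
  "newton f = convex hull {(real i, real j) | i j. coeff (coeff f j) i \<noteq> 0}"

definition newton_C :: "nat list \<Rightarrow> int \<Rightarrow> (real \<times> real) set" where
  "newton_C as h = convex hull
    ({(0, 0)} \<union> {(real (sum_list (take i as)), real i) | i. 1 \<le> i \<and> i \<le> length as}
     \<union> {(real_of_int h, real (length as)), (real_of_int h - real (length as), 0)})"

definition mc_from :: "(nat \<times> nat) set \<Rightarrow> nat \<Rightarrow> nat" where
  "mc_from r x = Max (card ` {C \<in> Chains r. x \<in> C \<and> (\<forall>t\<in>C. (x, t) \<in> r)})"

end

(*
  Write q^(n+1) = z. Splitting off up-sets, the generating function of the order-preserving maps
  P -> {0..n} equals the sum over up-sets U of z^|U| S(U) G(P - U), where G counts order-preserving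
  maps to the natural numbers and S is the convolution inverse of G, i.e. up to sign the generating
  function of strictly order-reversing maps. Since z is an affine function of [n]_q, this sum is
  E_P. All terms with |U| = k have the same sign, and the lowest power of q in q^|U| S(U) is the
  sum of the chain lengths mc(u) over u in U; its minimum over up-sets of size k is a_1 + ... + a_k.
  This determines the order at q = 0 of every coefficient of E_P. Expanding G and S in 1/q instead
  shows that the coefficient of x^j has degree at most j, with equality for j = m, and E_P(0) = 1.
  These orders and degrees are exactly the vertices and edges of the polygon.
*)
theory Submission
  imports Defs
begin

text \<open>The obstacle is cancellation of lowest terms, and three facts exclude it. After removal
  of the sign (-1)^|U|, S(U) has a positive leading coefficient at q = 0; the defining recursion of
  S hides this, but its alternating inversion over sets of maximal elements shows it. Since mc drops
  strictly on going up in P, the k elements of smallest mc form an up-set, so a_1 + ... + a_k is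
  attained. Finally, the coefficient of x^j mixes the powers z^k with k >= j, but every a_i is at
  least 1, so a_1 + ... + a_k grows strictly with k and only k = j reaches the lowest order. In 1/q
  upper bounds suffice, except at j = m, where a single term is left. The passage from E_P to N_P
  rests on E_P(0) = 1: the x-free coefficient of N_P is the denominator D itself, and h = deg D + m.
  No coefficient of E_P has a pole at q = 0, so D(0) = 0 would make q a common factor of N_P and D.
  Hence D(0) is nonzero, and multiplying by D preserves all orders at q = 0.\<close>

section \<open>Up-sets and sums over nested pairs of up-sets\<close>

definition up_sets :: "('a \<times> 'a) set \<Rightarrow> 'a set \<Rightarrow> 'a set set" where
  "up_sets r V = {U. U \<subseteq> V \<and> (\<forall>u\<in>U. \<forall>v\<in>V. (u, v) \<in> r \<longrightarrow> v \<in> U)}"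

lemma finite_up_sets [simp]: "finite V \<Longrightarrow> finite (up_sets r V)"
  by (rule finite_subset[of _ "Pow V"]) (auto simp: up_sets_def)

lemma empty_in_up_sets [simp]: "{} \<in> up_sets r V"
  and self_in_up_sets [simp]: "V \<in> up_sets r V"
  and up_sets_empty [simp]: "up_sets r {} = {{}}"
  by (auto simp: up_sets_def)

lemma up_sets_subset: "U \<in> up_sets r V \<Longrightarrow> U \<subseteq> V"
  by (auto simp: up_sets_def)

lemma up_sets_finite: "finite V \<Longrightarrow> U \<in> up_sets r V \<Longrightarrow> finite U"
  using up_sets_subset finite_subset by metis

text \<open>A nested pair is the same as \<open>U\<close> with an up-set \<open>Z = Y - U\<close> of
  the complement: whatever lies above an element of \<open>Z\<close> is in \<open>Z\<close> or in
  \<open>U\<close>, so \<open>U \<union> Z\<close> is again an up-set.\<close>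

lemma sum_up_sets_nested:
  fixes f :: "'a set \<Rightarrow> 'a set \<Rightarrow> 'b::comm_monoid_add"
  assumes "finite V"
  shows "(\<Sum>Y\<in>up_sets r V. \<Sum>U\<in>up_sets r Y. f U Y)
       = (\<Sum>U\<in>up_sets r V. \<Sum>Z\<in>up_sets r (V - U). f U (U \<union> Z))"
proof -
  have fin: "\<forall>Y\<in>up_sets r V. finite (up_sets r Y)" "\<forall>U\<in>up_sets r V. finite (up_sets r (V - U))"
    using assms by (auto dest: up_sets_finite)
  have "(\<Sum>Y\<in>up_sets r V. \<Sum>U\<in>up_sets r Y. f U Y)
      = (\<Sum>(Y, U)\<in>Sigma (up_sets r V) (up_sets r). f U Y)"
    using assms fin by (subst sum.Sigma) auto
  also have "\<dots> = (\<Sum>(U, Z)\<in>Sigma (up_sets r V) (\<lambda>U. up_sets r (V - U)). f U (U \<union> Z))"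
    by (rule sum.reindex_bij_witness[where j = "\<lambda>(Y, U). (U, Y - U)" and i = "\<lambda>(U, Z). (U \<union> Z, U)"])
       (auto simp: up_sets_def Un_absorb1, blast+)
  also have "\<dots> = (\<Sum>U\<in>up_sets r V. \<Sum>Z\<in>up_sets r (V - U). f U (U \<union> Z))"
    using assms fin by (subst sum.Sigma) auto
  finally show ?thesis .
qed

lemma sum_up_sets_Diff_card:
  assumes "finite V" "U \<in> up_sets r V" "Z \<in> up_sets r (V - U)"
  shows "card (U \<union> Z) = card U + card Z"
proof (rule card_Un_disjoint)
  show "finite U" "finite Z" "U \<inter> Z = {}"
    using assms up_sets_subset[OF assms(3)] by (auto intro: up_sets_finite)
qed

section \<open>Generating functions of order-preserving maps\<close>

text \<open>
  As rational functions in \<open>q\<close>, \<open>weak_gf q r V\<close> is the sum of \<open>q\<^bsup>|f|\<^esup>\<close> over the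
  order-preserving maps \<open>f\<close> from \<open>V\<close> to the natural numbers (split according to where \<open>f\<close> is
  positive), and \<open>(-1)\<^bsup>card V\<^esup> strict_gf q r V\<close> is the same sum over the strictly
  order-reversing maps.
\<close>
function weak_gf :: "'k::field \<Rightarrow> ('a \<times> 'a) set \<Rightarrow> 'a set \<Rightarrow> 'k" where
  "weak_gf q r V = (if finite V \<and> V \<noteq> {}
     then (\<Sum>U\<in>up_sets r V - {V}. q ^ card U * weak_gf q r U) / (1 - q ^ card V) else 1)"
  by auto
termination
  by (relation "inv_image less_than (\<lambda>(q, r, V). card V)") (auto intro!: psubset_card_mono dest: up_sets_subset)

function strict_gf :: "'k::field \<Rightarrow> ('a \<times> 'a) set \<Rightarrow> 'a set \<Rightarrow> 'k" where
  "strict_gf q r V = (if finite V \<and> V \<noteq> {}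
     then (\<Sum>T\<in>up_sets r V - {{}}. strict_gf q r (V - T)) / (q ^ card V - 1) else 1)"
  by auto
termination
  by (relation "inv_image less_than (\<lambda>(q, r, V). card V)") (auto intro!: psubset_card_mono dest: up_sets_subset)

declare weak_gf.simps [simp del] strict_gf.simps [simp del]

lemma weak_gf_empty [simp]: "weak_gf q r {} = 1"
  and strict_gf_empty [simp]: "strict_gf q r {} = 1"
  by (subst weak_gf.simps strict_gf.simps, simp)+

text \<open>The convolution of S and G with weight z^|U| at z = q^n. It belongs to maps into {0,
  ..., n - 1}, so the sum of the overview is its value at \<open>Suc n\<close>.\<close>

definition box_gf :: "'k::field \<Rightarrow> ('a \<times> 'a) set \<Rightarrow> 'a set \<Rightarrow> nat \<Rightarrow> 'k" where
  "box_gf q r V n = (\<Sum>U\<in>up_sets r V. (q ^ n) ^ card U * strict_gf q r U * weak_gf q r (V - U))"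

text \<open>The value 0 off \<open>V\<close> makes each map on \<open>V\<close> occur exactly once
  as a total function.\<close>

definition box_maps :: "('a \<times> 'a) set \<Rightarrow> 'a set \<Rightarrow> nat \<Rightarrow> ('a \<Rightarrow> nat) set" where
  "box_maps r V n = {f. (\<forall>i. i \<notin> V \<longrightarrow> f i = 0) \<and> (\<forall>i\<in>V. f i < n)
     \<and> (\<forall>i\<in>V. \<forall>j\<in>V. (i, j) \<in> r \<longrightarrow> f i \<le> f j)}"

lemma finite_box_maps: "finite V \<Longrightarrow> finite (box_maps r V n)"
  using finite_set_of_finite_funs[of V "{..<n}" 0]
  by (rule finite_subset[rotated]) (auto simp: box_maps_def)

text \<open>Monotonicity makes the set of positive values an up-set, and truncated subtraction
  leaves the zeros alone. This splitting gives \<open>box_maps\<close> the recursion that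
  \<open>box_gf_Suc\<close> proves for \<open>box_gf\<close>.\<close>

lemma box_maps_Suc_bij:
  "bij_betw (\<lambda>f. ({i \<in> V. f i > 0}, \<lambda>i. f i - 1)) (box_maps r V (Suc n))
     (Sigma (up_sets r V) (\<lambda>U. box_maps r U n))"
proof (rule bij_betwI[where g = "\<lambda>(U, f) i. if i \<in> U then Suc (f i) else 0"])
  show "(\<lambda>f. ({i \<in> V. f i > 0}, \<lambda>i. f i - 1)) \<in>
      box_maps r V (Suc n) \<rightarrow> Sigma (up_sets r V) (\<lambda>U. box_maps r U n)"
    by (fastforce simp: box_maps_def up_sets_def intro!: diff_le_mono)
  show "(\<lambda>(U, f) i. if i \<in> U then Suc (f i) else 0) \<in>
      Sigma (up_sets r V) (\<lambda>U. box_maps r U n) \<rightarrow> box_maps r V (Suc n)"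
    by (auto simp: box_maps_def up_sets_def)
next
  fix f assume "f \<in> box_maps r V (Suc n)"
  then show "(\<lambda>(U, f) i. if i \<in> U then Suc (f i) else 0) ({i \<in> V. f i > 0}, \<lambda>i. f i - 1) = f"
    by (auto simp: box_maps_def fun_eq_iff)
next
  fix p assume "p \<in> Sigma (up_sets r V) (\<lambda>U. box_maps r U n)"
  then obtain U f where p: "p = (U, f)" "U \<in> up_sets r V" "f \<in> box_maps r U n"
    by auto
  have "{i \<in> V. 0 < (if i \<in> U then Suc (f i) else 0)} = U"
    using up_sets_subset[OF p(2)] by auto
  moreover have "(\<lambda>i. (if i \<in> U then Suc (f i) else 0) - 1) = f"
    using p(3) by (auto simp: box_maps_def)
  ultimately show "({i \<in> V. (\<lambda>(U, f) i. if i \<in> U then Suc (f i) else 0) p i > 0},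
      \<lambda>i. (\<lambda>(U, f) i. if i \<in> U then Suc (f i) else 0) p i - 1) = p"
    using p(1) by simp
qed

context
  fixes q :: "'k::field"
  assumes q_power_neq_1: "\<And>n. n > 0 \<Longrightarrow> q ^ n \<noteq> 1"
begin

lemma weak_gf_proper:
  assumes "finite V" "V \<noteq> {}"
  shows "weak_gf q r V * (1 - q ^ card V) = (\<Sum>U\<in>up_sets r V - {V}. q ^ card U * weak_gf q r U)"
  using assms q_power_neq_1[of "card V"] by (subst weak_gf.simps) (simp add: card_gt_0_iff)

lemma weak_gf_rec:
  assumes "finite V"
  shows "weak_gf q r V = (\<Sum>U\<in>up_sets r V. q ^ card U * weak_gf q r U)"
proof (cases "V = {}")
  case False
  then show ?thesis
    using weak_gf_proper[of V r] assms
    by (subst sum.remove[of _ V]) (auto simp: algebra_simps)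
qed auto

lemma strict_gf_proper:
  assumes "finite V" "V \<noteq> {}"
  shows "strict_gf q r V * (q ^ card V - 1) = (\<Sum>T\<in>up_sets r V - {{}}. strict_gf q r (V - T))"
  using assms q_power_neq_1[of "card V"] by (subst strict_gf.simps) (simp add: card_gt_0_iff)

lemma strict_gf_rec:
  assumes "finite V"
  shows "q ^ card V * strict_gf q r V = (\<Sum>T\<in>up_sets r V. strict_gf q r (V - T))"
proof (cases "V = {}")
  case False
  then show ?thesis
    using strict_gf_proper[of V r] assms
    by (subst sum.remove[of _ "{}"]) (auto simp: algebra_simps)
qed auto

text \<open>Once the nested pairs are regrouped, the inner sum over \<open>Z\<close> is
  \<open>weak_gf_rec\<close> on \<open>V - U\<close>.\<close>

lemma box_gf_Suc:
  assumes V: "finite V"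
  shows "box_gf q r V (Suc n) = (\<Sum>Y\<in>up_sets r V. q ^ card Y * box_gf q r Y n)"
proof -
  have "(\<Sum>Y\<in>up_sets r V. q ^ card Y * box_gf q r Y n)
      = (\<Sum>Y\<in>up_sets r V. \<Sum>U\<in>up_sets r Y.
           q ^ card Y * ((q ^ n) ^ card U * strict_gf q r U * weak_gf q r (Y - U)))"
    by (simp add: box_gf_def sum_distrib_left)
  also have "\<dots> = (\<Sum>U\<in>up_sets r V. \<Sum>Z\<in>up_sets r (V - U).
           q ^ card (U \<union> Z) * ((q ^ n) ^ card U * strict_gf q r U * weak_gf q r (U \<union> Z - U)))"
    by (rule sum_up_sets_nested[OF V])
  also have "\<dots> = (\<Sum>U\<in>up_sets r V. \<Sum>Z\<in>up_sets r (V - U).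
           (q ^ Suc n) ^ card U * strict_gf q r U * (q ^ card Z * weak_gf q r Z))"
  proof (intro sum.cong refl)
    fix U Z assume *: "U \<in> up_sets r V" "Z \<in> up_sets r (V - U)"
    then have "U \<union> Z - U = Z"
      using up_sets_subset[of Z r "V - U"] by auto
    then show "q ^ card (U \<union> Z) * ((q ^ n) ^ card U * strict_gf q r U * weak_gf q r (U \<union> Z - U))
        = (q ^ Suc n) ^ card U * strict_gf q r U * (q ^ card Z * weak_gf q r Z)"
      using sum_up_sets_Diff_card[OF V *] by (simp add: power_add power_mult_distrib)
  qed
  also have "\<dots> = box_gf q r V (Suc n)"
    unfolding box_gf_def using V
    by (intro sum.cong refl) (simp add: weak_gf_rec[of "_ - _"] flip: sum_distrib_left)
  finally show ?thesis ..
qed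

text \<open>This is the statement that S and G are convolution inverses. The value at n = 1 is
  computed twice: by \<open>strict_gf_rec\<close> as a sum of values at 0 on \<open>V - T\<close>,
  by \<open>box_gf_Suc\<close> as a sum of values at 0 on \<open>Y\<close> with weight q^|Y|. By
  induction the two differ only in the weight of the term for \<open>V\<close>, so 1 - q^|V| times
  that term vanishes.\<close>

lemma box_gf_0:
  assumes "finite V"
  shows "box_gf q r V 0 = (if V = {} then 1 else 0)"
  using assms
proof (induction V rule: finite_psubset_induct)
  case (psubset V)
  show ?case
  proof (cases "V = {}")
    case True
    then show ?thesis by (simp add: box_gf_def)
  next
    case False
    have small: "box_gf q r Y 0 = (if Y = {} then 1 else 0)" if "Y \<in> up_sets r V" "Y \<noteq> V" for Y
      using that psubset up_sets_subset[OF that(1)] by blast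
    have "box_gf q r V (Suc 0) = (\<Sum>U\<in>up_sets r V. \<Sum>T\<in>up_sets r U.
        strict_gf q r (U - T) * weak_gf q r (V - U))"
      unfolding box_gf_def using psubset(1) up_sets_finite[of V _ r]
      by (intro sum.cong refl) (simp add: strict_gf_rec flip: sum_distrib_right)
    also have "\<dots> = (\<Sum>T\<in>up_sets r V. \<Sum>Z\<in>up_sets r (V - T).
        strict_gf q r (T \<union> Z - T) * weak_gf q r (V - (T \<union> Z)))"
      by (rule sum_up_sets_nested[OF psubset(1)])
    also have "\<dots> = (\<Sum>T\<in>up_sets r V. box_gf q r (V - T) 0)"
      unfolding box_gf_def
    proof (intro sum.cong refl)
      fix T Z assume "Z \<in> up_sets r (V - T)"
      then have "T \<union> Z - T = Z" "V - (T \<union> Z) = V - T - Z"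
        using up_sets_subset[of Z r "V - T"] by auto
      then show "strict_gf q r (T \<union> Z - T) * weak_gf q r (V - (T \<union> Z))
        = (q ^ 0) ^ card Z * strict_gf q r Z * weak_gf q r (V - T - Z)"
        by simp
    qed
    also have "\<dots> = box_gf q r V 0 + (\<Sum>T\<in>up_sets r V - {{}}. if T = V then 1 else 0)"
    proof -
      have "box_gf q r (V - T) 0 = (if T = V then 1 else 0)" if "T \<in> up_sets r V - {{}}" for T
      proof -
        have "V - T \<subset> V" "V - T = {} \<longleftrightarrow> T = V" using that up_sets_subset[of T r V] by auto
        then show ?thesis using psubset(2)[of "V - T"] by simp
      qed
      then show ?thesis
        using psubset(1) by (subst sum.remove[of _ "{}"]) auto
    qed
    also have "\<dots> = box_gf q r V 0 + 1"
      using False psubset(1) by (simp add: sum.delta)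
    finally have 1: "box_gf q r V (Suc 0) = box_gf q r V 0 + 1" .
    have "box_gf q r V (Suc 0) = (\<Sum>Y\<in>up_sets r V. q ^ card Y * box_gf q r Y 0)"
      by (rule box_gf_Suc[OF psubset(1)])
    also have "\<dots> = q ^ card V * box_gf q r V 0 + (\<Sum>Y\<in>up_sets r V - {V}. if Y = {} then 1 else 0)"
    proof -
      have "(\<Sum>Y\<in>up_sets r V - {V}. q ^ card Y * box_gf q r Y 0)
          = (\<Sum>Y\<in>up_sets r V - {V}. if Y = {} then 1 else 0)"
        by (intro sum.cong) (auto simp: small)
      then show ?thesis
        using psubset(1) by (subst sum.remove[of _ V]) auto
    qed
    also have "\<dots> = q ^ card V * box_gf q r V 0 + 1"
      using False psubset(1) by (simp add: sum.delta)
    finally have "(1 - q ^ card V) * box_gf q r V 0 = 0"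
      using 1 by (simp add: algebra_simps)
    then show ?thesis
      using False q_power_neq_1[of "card V"] psubset(1) by (simp add: card_gt_0_iff)
  qed
qed

lemma box_maps_sum:
  assumes "finite V"
  shows "(\<Sum>f\<in>box_maps r V n. q ^ (\<Sum>i\<in>V. f i)) = box_gf q r V n"
  using assms
proof (induction n arbitrary: V)
  case 0
  then show ?case
    by (auto simp: box_gf_0 box_maps_def simp flip: fun_eq_iff)
next
  case (Suc n)
  have "q ^ (\<Sum>i\<in>V. f i) = q ^ card {i\<in>V. f i > 0} * q ^ (\<Sum>i\<in>{i\<in>V. f i > 0}. f i - 1)"
    for f :: "'a \<Rightarrow> nat"
  proof -
    have "(\<Sum>i\<in>V. f i) = (\<Sum>i\<in>{i\<in>V. f i > 0}. f i)"
      using Suc.prems by (intro sum.mono_neutral_right) auto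
    also have "\<dots> = (\<Sum>i\<in>{i\<in>V. f i > 0}. 1 + (f i - 1))"
      by (intro sum.cong) auto
    also have "\<dots> = card {i\<in>V. f i > 0} + (\<Sum>i\<in>{i\<in>V. f i > 0}. f i - 1)"
      by (subst sum.distrib) simp
    finally show ?thesis by (simp add: power_add)
  qed
  then have "(\<Sum>f\<in>box_maps r V (Suc n). q ^ (\<Sum>i\<in>V. f i))
      = (\<Sum>(U, f)\<in>Sigma (up_sets r V) (\<lambda>U. box_maps r U n). q ^ card U * q ^ (\<Sum>i\<in>U. f i))"
    by (subst sum.reindex_bij_betw[OF box_maps_Suc_bij, symmetric]) simp
  also have "\<dots> = (\<Sum>U\<in>up_sets r V. \<Sum>f\<in>box_maps r U n. q ^ card U * q ^ (\<Sum>i\<in>U. f i))"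
    using Suc.prems by (subst sum.Sigma) (auto intro: finite_box_maps up_sets_finite)
  also have "\<dots> = (\<Sum>U\<in>up_sets r V. q ^ card U * box_gf q r U n)"
    using Suc.prems
    by (intro sum.cong refl) (simp add: Suc.IH[OF up_sets_finite] flip: sum_distrib_left)
  finally show ?case
    using Suc.prems by (simp add: box_gf_Suc)
qed

end

section \<open>Chains and maximal elements\<close>

definition max_elts :: "('a \<times> 'a) set \<Rightarrow> 'a set \<Rightarrow> 'a set" where
  "max_elts r U = {u \<in> U. \<forall>v\<in>U. (u, v) \<in> r \<longrightarrow> v = u}"

lemma max_elts_subset: "max_elts r U \<subseteq> U"
  by (auto simp: max_elts_def)

text \<open>Climbing to a strictly larger element leaves fewer elements strictly above.\<close>

lemma ex_max_elt_above:
  assumes "finite U" "antisym r" "trans r" "u \<in> U"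
  shows "u \<in> max_elts r U \<or> (\<exists>v\<in>max_elts r U. (u, v) \<in> r)"
  using assms(4)
proof (induction "card {v \<in> U. (u, v) \<in> r \<and> u \<noteq> v}" arbitrary: u rule: less_induct)
  case less
  show ?case
  proof (cases "u \<in> max_elts r U")
    case False
    then obtain v where v: "v \<in> U" "(u, v) \<in> r" "v \<noteq> u"
      using less.prems by (auto simp: max_elts_def)
    have "{w \<in> U. (v, w) \<in> r \<and> v \<noteq> w} \<subseteq> {w \<in> U. (u, w) \<in> r \<and> u \<noteq> w}"
      using v assms(2,3) by (auto dest: transD antisymD)
    moreover have "v \<in> {w \<in> U. (u, w) \<in> r \<and> u \<noteq> w}" "v \<notin> {w \<in> U. (v, w) \<in> r \<and> v \<noteq> w}"
      using v by auto
    ultimately have "{w \<in> U. (v, w) \<in> r \<and> v \<noteq> w} \<subset> {w \<in> U. (u, w) \<in> r \<and> u \<noteq> w}"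
      by blast
    then have "card {w \<in> U. (v, w) \<in> r \<and> v \<noteq> w} < card {w \<in> U. (u, w) \<in> r \<and> u \<noteq> w}"
      using assms(1) by (intro psubset_card_mono) auto
    from less.hyps[OF this v(1)] v show ?thesis
      using assms(3) by (blast dest: transD)
  qed simp
qed

lemma sum_Pow_alternating:
  assumes "finite M"
  shows "(\<Sum>A\<in>Pow M. (-1) ^ card A) = (if M = {} then 1 else 0 :: 'b::ring_1)"
  using assms
proof (induction rule: finite_induct)
  case (insert x M)
  have inj: "inj_on (insert x) (Pow M)"
    using insert.hyps by (auto simp: inj_on_def)
  have "(\<Sum>A\<in>insert x ` Pow M. (-1) ^ card A) = (\<Sum>A\<in>Pow M. (-1) * (-1) ^ card A :: 'b)"
    unfolding sum.reindex[OF inj]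
  proof (intro sum.cong refl)
    fix A assume "A \<in> Pow M"
    then have "finite A" "x \<notin> A" using insert.hyps finite_subset by auto
    then show "((\<lambda>A. (-1) ^ card A) \<circ> insert x) A = (-1) * (-1) ^ card A" by simp
  qed
  then show ?case
    using insert.hyps
    by (subst Pow_insert, subst sum.union_disjoint) (auto simp: sum_negf)
qed simp

context
  fixes q :: "'k::field"
  assumes q_power_neq_1: "\<And>n. n > 0 \<Longrightarrow> q ^ n \<noteq> 1"
begin

text \<open>
  The terms of this recursion all have the sign \<open>(-1)\<^bsup>card U\<^esup>\<close>, so that, unlike in the
  defining recursion, leading terms at \<open>q = 0\<close> cannot cancel.
\<close>
lemma strict_gf_antichain_rec:
  assumes U: "finite U" and r: "antisym r" "trans r"
  shows "strict_gf q r U =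
    (\<Sum>A\<in>Pow (max_elts r U). (-1) ^ card A * (q ^ card (U - A) * strict_gf q r (U - A)))"
proof -
  \<comment> \<open>Combinatorially, \<open>A\<close> is the zero set of a strictly order-reversing
    map, which can only consist of maximal elements.\<close>
  let ?M = "max_elts r U"
  have fin: "finite ?M" "\<And>A. finite (U - A)" "\<And>B. finite (?M \<inter> B)"
    using U max_elts_subset[of r U] finite_subset by auto
  have "(\<Sum>A\<in>Pow ?M. (-1) ^ card A * (q ^ card (U - A) * strict_gf q r (U - A)))
      = (\<Sum>A\<in>Pow ?M. \<Sum>T\<in>up_sets r (U - A). (-1) ^ card A * strict_gf q r (U - A - T))"
    using fin by (simp add: strict_gf_rec q_power_neq_1 sum_distrib_left)
  also have "\<dots> = (\<Sum>(A, T)\<in>Sigma (Pow ?M) (\<lambda>A. up_sets r (U - A)).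
        (-1) ^ card A * strict_gf q r (U - A - T))"
    using fin by (subst sum.Sigma) auto
  \<comment> \<open>With \<open>B = A \<union> T\<close>, a term depends on \<open>A\<close> only
    through its sign, and \<open>A\<close> runs over all sets of maximal elements inside
    \<open>B\<close>. The alternating sum vanishes unless there are none, which for an up-set means
    that \<open>B\<close> is empty.\<close>
  also have "\<dots> = (\<Sum>(B, A)\<in>Sigma (up_sets r U) (\<lambda>B. Pow (?M \<inter> B)).
        (-1) ^ card A * strict_gf q r (U - B))"
  proof (rule sum.reindex_bij_witness[where j = "\<lambda>(A, T). (A \<union> T, A)" and i = "\<lambda>(B, A). (A, B - A)"])
    fix p assume "p \<in> Sigma (Pow ?M) (\<lambda>A. up_sets r (U - A))"
    then obtain A T where p: "p = (A, T)" "A \<subseteq> ?M" "T \<in> up_sets r (U - A)"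
      by auto
    have "A \<union> T - A = T" "U - (A \<union> T) = U - A - T"
      using up_sets_subset[OF p(3)] by auto
    moreover have "A \<union> T \<in> up_sets r U"
      using p(2,3) by (fastforce simp: up_sets_def max_elts_def)
    ultimately show "(case case p of (A, T) \<Rightarrow> (A \<union> T, A) of (B, A) \<Rightarrow> (A, B - A)) = p"
      and "(case p of (A, T) \<Rightarrow> (A \<union> T, A)) \<in> Sigma (up_sets r U) (\<lambda>B. Pow (?M \<inter> B))"
      and "(case case p of (A, T) \<Rightarrow> (A \<union> T, A) of (B, A) \<Rightarrow> (-1) ^ card A * strict_gf q r (U - B))
         = (case p of (A, T) \<Rightarrow> (-1) ^ card A * strict_gf q r (U - A - T))"
      using p by auto
  next
    fix p assume "p \<in> Sigma (up_sets r U) (\<lambda>B. Pow (?M \<inter> B))"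
    then show "(case case p of (B, A) \<Rightarrow> (A, B - A) of (A, T) \<Rightarrow> (A \<union> T, A)) = p"
      and "(case p of (B, A) \<Rightarrow> (A, B - A)) \<in> Sigma (Pow ?M) (\<lambda>A. up_sets r (U - A))"
      by (auto simp: up_sets_def)
  qed
  also have "\<dots> = (\<Sum>B\<in>up_sets r U. \<Sum>A\<in>Pow (?M \<inter> B). (-1) ^ card A * strict_gf q r (U - B))"
    using fin U by (subst sum.Sigma) auto
  also have "\<dots> = (\<Sum>B\<in>up_sets r U. (if ?M \<inter> B = {} then 1 else 0) * strict_gf q r (U - B))"
    by (intro sum.cong refl)
      (simp only: sum_distrib_right[symmetric] sum_Pow_alternating[OF fin(3)])
  also have "\<dots> = (\<Sum>B\<in>up_sets r U. if B = {} then strict_gf q r U else 0)"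
  proof (intro sum.cong refl)
    fix B assume B: "B \<in> up_sets r U"
    have "?M \<inter> B \<noteq> {}" if "u \<in> B" for u
      using ex_max_elt_above[OF U r, of u] that B max_elts_subset[of r U]
      by (fastforce simp: up_sets_def)
    then have "?M \<inter> B = {} \<longleftrightarrow> B = {}" by blast
    then show "(if ?M \<inter> B = {} then 1 else 0) * strict_gf q r (U - B)
        = (if B = {} then strict_gf q r U else 0)"
      by simp
  qed
  also have "\<dots> = strict_gf q r U"
    using U by simp
  finally show ?thesis ..
qed

end

section \<open>Chain lengths within a subset and their change when maximal elements are
  deleted\<close>

text \<open>Relative to \<open>U\<close>, because the induction for S deletes maximal elements.
  Passing to an up-set changes nothing, since a chain that starts there stays there.\<close>

definition mc_in :: "('a \<times> 'a) set \<Rightarrow> 'a set \<Rightarrow> 'a \<Rightarrow> nat" where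
  "mc_in r U x = Max (card ` {C \<in> Chains r. C \<subseteq> U \<and> x \<in> C \<and> (\<forall>t\<in>C. (x, t) \<in> r)})"

lemma mc_from_eq_mc_in:
  assumes "r \<subseteq> V \<times> V"
  shows "mc_from r x = mc_in r V x"
proof -
  have "{C \<in> Chains r. x \<in> C \<and> (\<forall>t\<in>C. (x, t) \<in> r)}
      = {C \<in> Chains r. C \<subseteq> V \<and> x \<in> C \<and> (\<forall>t\<in>C. (x, t) \<in> r)}"
    using assms by auto
  then show ?thesis by (simp add: mc_from_def mc_in_def)
qed

lemma mc_in_up_set:
  assumes "U \<in> up_sets r V" "x \<in> U"
  shows "mc_in r U x = mc_in r V x"
proof -
  have "{C \<in> Chains r. C \<subseteq> U \<and> x \<in> C \<and> (\<forall>t\<in>C. (x, t) \<in> r)}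
      = {C \<in> Chains r. C \<subseteq> V \<and> x \<in> C \<and> (\<forall>t\<in>C. (x, t) \<in> r)}"
    using assms unfolding up_sets_def by blast
  then show ?thesis by (simp add: mc_in_def)
qed

lemma mc_in_ge:
  assumes "finite U" "C \<in> Chains r" "C \<subseteq> U" "x \<in> C" "\<And>t. t \<in> C \<Longrightarrow> (x, t) \<in> r"
  shows "card C \<le> mc_in r U x"
  unfolding mc_in_def
proof (rule Max_ge)
  show "finite (card ` {C \<in> Chains r. C \<subseteq> U \<and> x \<in> C \<and> (\<forall>t\<in>C. (x, t) \<in> r)})"
    by (rule finite_imageI, rule finite_subset[of _ "Pow U"]) (use assms(1) in auto)
  show "card C \<in> card ` {C \<in> Chains r. C \<subseteq> U \<and> x \<in> C \<and> (\<forall>t\<in>C. (x, t) \<in> r)}"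
    by (rule imageI) (use assms in blast)
qed

lemma mc_in_obtain:
  assumes "finite U" "(x, x) \<in> r" "x \<in> U"
  obtains C where "C \<in> Chains r" "C \<subseteq> U" "x \<in> C" "\<And>t. t \<in> C \<Longrightarrow> (x, t) \<in> r" "card C = mc_in r U x"
proof -
  let ?S = "{C \<in> Chains r. C \<subseteq> U \<and> x \<in> C \<and> (\<forall>t\<in>C. (x, t) \<in> r)}"
  have "finite ?S" by (rule finite_subset[of _ "Pow U"]) (use assms(1) in auto)
  moreover have "{x} \<in> ?S" using assms by (auto simp: Chains_def)
  ultimately have "Max (card ` ?S) \<in> card ` ?S" by (intro Max_in) auto
  then show ?thesis using that by (auto simp: mc_in_def)
qed

lemma mc_in_pos:
  assumes "finite U" "(x, x) \<in> r" "x \<in> U"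
  shows "mc_in r U x > 0"
  using mc_in_ge[of U "{x}" r x] assms by (auto simp: Chains_def)

text \<open>\<open>x\<close> can be put below a longest chain from \<open>y\<close>. The strictness
  is what will make a set of elements of smallest chain length an up-set.\<close>

lemma mc_in_less:
  assumes U: "finite U" and r: "antisym r" "trans r" "(x, x) \<in> r" "(y, y) \<in> r"
    and xy: "x \<in> U" "y \<in> U" "(x, y) \<in> r" "x \<noteq> y"
  shows "mc_in r U y < mc_in r U x"
proof -
  obtain C where C: "C \<in> Chains r" "C \<subseteq> U" "y \<in> C" "\<And>t. t \<in> C \<Longrightarrow> (y, t) \<in> r" "card C = mc_in r U y"
    using mc_in_obtain[OF U r(4) xy(2)] by metis
  have above: "(x, t) \<in> r" if "t \<in> C" for t
    using C(4)[OF that] xy(3) r(2) by (blast dest: transD)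
  have "x \<notin> C"
    using C(4) xy r(1) by (auto dest: antisymD)
  moreover have "finite C" using C(2) U finite_subset by auto
  ultimately have "card (insert x C) = Suc (mc_in r U y)"
    using C(5) by simp
  moreover have "card (insert x C) \<le> mc_in r U x"
    using C above xy r(3) U by (intro mc_in_ge) (auto simp: Chains_def)
  ultimately show ?thesis by simp
qed

lemma mc_in_max_elt:
  assumes "finite U" "x \<in> max_elts r U" "(x, x) \<in> r"
  shows "mc_in r U x = 1"
proof -
  have "x \<in> U" using assms(2) by (simp add: max_elts_def)
  then obtain C where C: "C \<subseteq> U" "x \<in> C" "\<And>t. t \<in> C \<Longrightarrow> (x, t) \<in> r" "card C = mc_in r U x"
    using mc_in_obtain[OF assms(1,3)] by metis
  then have "C = {x}" using assms(2) unfolding max_elts_def by blast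
  then show ?thesis using C(4) by simp
qed

text \<open>\<open>A\<close> is an antichain, so a chain loses at most one element.\<close>

lemma mc_in_Diff_ge:
  assumes U: "finite U" and A: "A \<subseteq> max_elts r U" and x: "x \<in> U - A" "(x, x) \<in> r"
  shows "mc_in r U x \<le> Suc (mc_in r (U - A) x)"
proof -
  obtain C where C: "C \<in> Chains r" "C \<subseteq> U" "x \<in> C" "\<And>t. t \<in> C \<Longrightarrow> (x, t) \<in> r" "card C = mc_in r U x"
    using mc_in_obtain[of U x r] U x by (metis DiffD1)
  have fin: "finite C" using C(2) U finite_subset by auto
  have "u = v" if "u \<in> C \<inter> A" "v \<in> C \<inter> A" for u v
    using that C(1,2) A unfolding Chains_def max_elts_def subset_iff by blast
  then have "card (C \<inter> A) \<le> 1"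
    using fin by (auto simp: card_le_Suc0_iff_eq)
  moreover have "card C = card (C \<inter> A) + card (C - A)"
    using fin by (metis card_Int_Diff)
  moreover have "card (C - A) \<le> mc_in r (U - A) x"
    using C x U by (intro mc_in_ge) (auto simp: Chains_def)
  ultimately show ?thesis using C(5) by simp
qed

text \<open>A longest chain that avoids the maximal elements has a non-maximal top, above which a
  maximal element can be added. With \<open>mc_in_Diff_ge\<close>, deleting all maximal elements
  lowers \<open>mc_in\<close> by exactly one.\<close>

lemma mc_in_Diff_max_elts:
  assumes U: "finite U" and r: "antisym r" "trans r" "refl_on U r" and x: "x \<in> U - max_elts r U"
  shows "Suc (mc_in r (U - max_elts r U) x) \<le> mc_in r U x"
proof -
  let ?M = "max_elts r U"
  have xx: "(x, x) \<in> r" using x r(3) by (auto simp: refl_on_def)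
  obtain C where C: "C \<in> Chains r" "C \<subseteq> U - ?M" "x \<in> C" "\<And>t. t \<in> C \<Longrightarrow> (x, t) \<in> r"
      "card C = mc_in r (U - ?M) x"
    using mc_in_obtain[OF finite_Diff[OF U] xx x] by metis
  have fin: "finite C" using C(2) U finite_subset by (metis finite_Diff)
  obtain c where c: "c \<in> max_elts r C"
    using ex_max_elt_above[OF fin r(1,2) C(3)] by blast
  have c_top: "(t, c) \<in> r" if "t \<in> C" for t
    using that c C(1) unfolding max_elts_def Chains_def by blast
  have cC: "c \<in> C" using c by (simp add: max_elts_def)
  then have "c \<in> U" "c \<notin> ?M" using C(2) by auto
  then obtain v where v: "v \<in> ?M" "(c, v) \<in> r"
    using ex_max_elt_above[OF U r(1,2)] by blast
  have above: "(t, v) \<in> r" if "t \<in> C" for t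
    using c_top[OF that] v(2) r(2) by (blast dest: transD)
  have "v \<notin> C" "v \<in> U" using v(1) C(2) max_elts_subset[of r U] by auto
  moreover have "card (insert v C) \<le> mc_in r U x"
    using C above U \<open>v \<in> U\<close> r(3) by (intro mc_in_ge) (auto simp: Chains_def refl_on_def)
  ultimately show ?thesis using C(5) fin by simp
qed

section \<open>Leading terms\<close>

lemma map_poly_add_hom:
  assumes "f 0 = 0" "\<And>a b. f (a + b) = f a + f b"
  shows "map_poly f (p + p') = map_poly f p + map_poly f p'"
  by (rule poly_eqI) (simp add: coeff_map_poly assms)

lemma map_poly_mult_hom:
  assumes "f 0 = 0" "\<And>a b. f (a + b) = f a + f b" "\<And>a b. f (a * b) = f a * f b"
  shows "map_poly f (p * p') = map_poly f p * map_poly f p'"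
proof (rule poly_eqI)
  fix n
  have sum_hom: "f (sum g A) = (\<Sum>x\<in>A. f (g x))" for g and A :: "nat set"
    by (induction A rule: infinite_finite_induct) (simp_all add: assms)
  show "coeff (map_poly f (p * p')) n = coeff (map_poly f p * map_poly f p') n"
    by (simp add: coeff_map_poly assms coeff_mult sum_hom)
qed

definition const_fract :: "'a::idom \<Rightarrow> 'a poly fract" where
  "const_fract c = to_fract [:c:]"

lemma const_fract_simps [simp]:
  "const_fract 0 = 0" "const_fract 1 = 1"
  "const_fract (a + b) = const_fract a + const_fract b"
  "const_fract (- a) = - const_fract a"
  "const_fract (a * b) = const_fract a * const_fract b"
proof -
  show "const_fract 1 = 1" by (simp add: const_fract_def flip: one_pCons)
  have "[:a + b:] = [:a:] + [:b:]" "[:a * b:] = [:a:] * [:b:]" "[:- a:] = - [:a:]" by simp_all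
  then show "const_fract (a + b) = const_fract a + const_fract b"
    "const_fract (a * b) = const_fract a * const_fract b" "const_fract (- a) = - const_fract a"
    unfolding const_fract_def by (simp_all only: to_fract_add to_fract_mult to_fract_uminus)
qed (simp add: const_fract_def)

lemma const_fract_power [simp]: "const_fract (a ^ n) = const_fract a ^ n"
  by (induction n) simp_all

lemma const_fract_of_nat [simp]: "const_fract (of_nat n) = of_nat n"
  by (induction n) simp_all

text \<open>The values lie in the field of fractions so that t = 1/q can be substituted as well as t
  = q.\<close>

definition peval :: "'a::idom poly fract \<Rightarrow> 'a poly \<Rightarrow> 'a poly fract" where
  "peval t p = poly (map_poly const_fract p) t"

lemma peval_simps [simp]:
  "peval t 0 = 0" "peval t 1 = 1"
  "peval t (p + p') = peval t p + peval t p'"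
  "peval t (p * p') = peval t p * peval t p'"
  "peval t (monom c n) = const_fract c * t ^ n"
  by (simp_all add: peval_def map_poly_add_hom map_poly_mult_hom map_poly_monom poly_monom)

lemma peval_diff [simp]: "peval t (p - p') = peval t p - peval t p'"
  using peval_simps(3)[of t "p - p'" p'] by simp

text \<open>
  For \<open>t = q\<close> or \<open>t = 1/q\<close>, this says that \<open>f = c t\<^sup>a + O(t\<^bsup>a+1\<^esup>)\<close> as a Laurent series in \<open>t\<close>.
\<close>
definition has_lead :: "'a::idom poly fract \<Rightarrow> nat \<Rightarrow> 'a \<Rightarrow> 'a poly fract \<Rightarrow> bool" where
  "has_lead t a c f \<longleftrightarrow>
     (\<exists>p d. coeff p 0 = c \<and> coeff d 0 = 1 \<and> f * peval t d = t ^ a * peval t p)"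

lemma has_lead_0: "has_lead t a 0 0"
  unfolding has_lead_def by (intro exI[of _ 0] exI[of _ 1]) simp

lemma has_lead_const: "has_lead t 0 c (const_fract c)"
  unfolding has_lead_def by (intro exI[of _ "monom c 0"] exI[of _ 1]) simp

lemma has_lead_of_nat: "has_lead t 0 (of_nat n) (of_nat n)"
  using has_lead_const[of t "of_nat n"] by simp

lemma has_lead_minus_one_power: "has_lead t 0 ((-1) ^ n) ((-1) ^ n)"
  using has_lead_const[of t "(-1) ^ n"] by simp

lemma has_lead_one: "has_lead t 0 1 1"
  using has_lead_const[of t 1] by simp

lemma has_lead_power: "has_lead t n 1 (t ^ n)"
  unfolding has_lead_def by (intro exI[of _ 1]) simp

lemma has_lead_one_minus_power: "n > 0 \<Longrightarrow> has_lead t 0 1 (1 - t ^ n)"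
  unfolding has_lead_def by (intro exI[of _ "1 - monom 1 n"] exI[of _ 1]) simp

lemma has_lead_add:
  assumes "has_lead t a c f" "has_lead t a c' f'"
  shows "has_lead t a (c + c') (f + f')"
proof -
  obtain p d p' d' where *: "coeff p 0 = c" "coeff d 0 = 1" "f * peval t d = t ^ a * peval t p"
    "coeff p' 0 = c'" "coeff d' 0 = 1" "f' * peval t d' = t ^ a * peval t p'"
    using assms unfolding has_lead_def by blast
  have "(f + f') * peval t (d * d') = (f * peval t d) * peval t d' + (f' * peval t d') * peval t d"
    by (simp add: algebra_simps)
  also have "\<dots> = t ^ a * peval t (p * d' + p' * d)"
    unfolding * by (simp add: algebra_simps)
  finally show ?thesis
    unfolding has_lead_def using *
    by (intro exI[of _ "p * d' + p' * d"] exI[of _ "d * d'"]) (simp add: coeff_mult_0)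
qed

lemma has_lead_sum:
  assumes "\<And>x. x \<in> A \<Longrightarrow> has_lead t a (c x) (f x)"
  shows "has_lead t a (\<Sum>x\<in>A. c x) (\<Sum>x\<in>A. f x)"
  using assms
  by (induction A rule: infinite_finite_induct) (auto intro!: has_lead_add has_lead_0)

lemma has_lead_mult:
  assumes "has_lead t a c f" "has_lead t a' c' f'"
  shows "has_lead t (a + a') (c * c') (f * f')"
proof -
  obtain p d p' d' where *: "coeff p 0 = c" "coeff d 0 = 1" "f * peval t d = t ^ a * peval t p"
    "coeff p' 0 = c'" "coeff d' 0 = 1" "f' * peval t d' = t ^ a' * peval t p'"
    using assms unfolding has_lead_def by blast
  have "(f * f') * peval t (d * d') = (f * peval t d) * (f' * peval t d')"
    by (simp add: algebra_simps)
  also have "\<dots> = t ^ (a + a') * peval t (p * p')"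
    unfolding * by (simp add: algebra_simps power_add)
  finally show ?thesis
    unfolding has_lead_def using *
    by (intro exI[of _ "p * p'"] exI[of _ "d * d'"]) (simp add: coeff_mult_0)
qed

text \<open>Brings terms of different orders to a common exponent, as \<open>has_lead_sum\<close>
  requires; those of higher order then have coefficient 0.\<close>

lemma has_lead_mono:
  assumes "has_lead t a c f" "b \<le> a"
  shows "has_lead t b (if a = b then c else 0) f"
proof -
  obtain p d where *: "coeff p 0 = c" "coeff d 0 = 1" "f * peval t d = t ^ a * peval t p"
    using assms unfolding has_lead_def by blast
  have "t ^ a = t ^ b * t ^ (a - b)"
    using assms(2) by (simp flip: power_add)
  then show ?thesis
    unfolding has_lead_def using * assms(2)
    by (intro exI[of _ "monom 1 (a - b) * p"] exI[of _ d]) (auto simp: coeff_mult_0)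
qed

text \<open>The factor has constant term 1 and can join the denominator \<open>d\<close>. This
  solves the recursions for S and G, whose denominators have this form up to sign and a power of
  t.\<close>

lemma has_lead_divide_one_minus_power:
  assumes "has_lead t a c (f * (1 - t ^ n))" "n > 0"
  shows "has_lead t a c f"
proof -
  obtain p d where *: "coeff p 0 = c" "coeff d 0 = 1" "f * (1 - t ^ n) * peval t d = t ^ a * peval t p"
    using assms unfolding has_lead_def by blast
  then show ?thesis
    unfolding has_lead_def using assms(2)
    by (intro exI[of _ p] exI[of _ "(1 - monom 1 n) * d"]) (auto simp: coeff_mult_0 mult.assoc)
qed

lemma has_lead_cancel_power:
  assumes "has_lead t (a + n) c (f * t ^ n)" "t \<noteq> 0"
  shows "has_lead t a c f"
  using assms unfolding has_lead_def by (auto simp: power_add mult_ac)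

section \<open>Leading terms of the generating functions\<close>

lemma qvar_nz [simp]: "qvar \<noteq> 0"
  by (simp add: qvar_def)

lemma qvar_power: "qvar ^ n = to_fract (monom 1 n)"
proof (induction n)
  case (Suc n)
  then show ?case
    by (simp add: qvar_def mult_monom flip: to_fract_mult)
qed (simp flip: one_pCons)

lemma qvar_power_eq_iff: "qvar ^ m = qvar ^ n \<longleftrightarrow> m = n"
  by (simp add: qvar_power monom_eq_iff')

lemma qvar_power_neq_1: "n > 0 \<Longrightarrow> qvar ^ n \<noteq> 1"
  using qvar_power_eq_iff[of n 0] by simp

text \<open>In the recursion every summand except the one for the empty up-set carries a factor
  q.\<close>

lemma has_lead_weak_gf:
  assumes "finite V"
  shows "has_lead qvar 0 1 (weak_gf qvar r V)"
  using assms
proof (induction V rule: finite_psubset_induct)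
  case (psubset V)
  show ?case
  proof (cases "V = {}")
    case True
    then show ?thesis by (simp add: weak_gf_empty has_lead_one)
  next
    case False
    let ?S = "up_sets r V - {V}"
    have "has_lead qvar 0 (if U = {} then 1 else 0) (qvar ^ card U * weak_gf qvar r U)"
      if "U \<in> ?S" for U
    proof -
      have "U \<subset> V" "finite U" using that psubset(1) by (auto dest: up_sets_subset up_sets_finite)
      then have "has_lead qvar (card U + 0) (1 * 1) (qvar ^ card U * weak_gf qvar r U)"
        by (intro has_lead_mult has_lead_power psubset)
      from has_lead_mono[OF this, of 0] \<open>finite U\<close> show ?thesis by (cases "U = {}") simp_all
    qed
    then have "has_lead qvar 0 (\<Sum>U\<in>?S. if U = {} then 1 else 0)
        (\<Sum>U\<in>?S. qvar ^ card U * weak_gf qvar r U)"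
      by (rule has_lead_sum)
    moreover have "(\<Sum>U\<in>?S. if U = {} then 1 else 0) = (1 :: rat)"
      using False psubset(1) by simp
    ultimately have "has_lead qvar 0 1 (weak_gf qvar r V * (1 - qvar ^ card V))"
      by (simp only: weak_gf_proper[OF qvar_power_neq_1 psubset(1) False])
    then show ?thesis
      by (rule has_lead_divide_one_minus_power) (simp add: False psubset(1) card_gt_0_iff)
  qed
qed

text \<open>By induction each q^|U| G(U) has order at least 0 in 1/q, and dividing by 1 - q^|V|
  raises the order by |V|. An order suffices here, so the coefficient is left open.\<close>

lemma has_lead_inverse_weak_gf:
  assumes "finite V"
  shows "\<exists>c. has_lead (1 / qvar) (card V) c (weak_gf qvar r V)"
  using assms
proof (induction V rule: finite_psubset_induct)
  case (psubset V)
  show ?case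
  proof (cases "V = {}")
    case True
    then show ?thesis using has_lead_one[of "1 / qvar"] by (auto simp: weak_gf_empty)
  next
    case False
    let ?S = "up_sets r V - {V}" and ?t = "1 / qvar"
    have "\<exists>c. has_lead ?t 0 c (qvar ^ card U * weak_gf qvar r U)" if "U \<in> ?S" for U
    proof -
      have "U \<subset> V" using that by (auto dest: up_sets_subset)
      then obtain c where "has_lead ?t (card U) c (weak_gf qvar r U)" using psubset by blast
      then have "has_lead ?t 0 c (qvar ^ card U * weak_gf qvar r U)"
        using has_lead_cancel_power[of ?t 0 "card U" c "qvar ^ card U * weak_gf qvar r U"]
        by (simp add: power_one_over)
      then show ?thesis ..
    qed
    then obtain c where "has_lead ?t 0 (c U) (qvar ^ card U * weak_gf qvar r U)" if "U \<in> ?S" for U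
      by metis
    then have "has_lead ?t 0 (\<Sum>U\<in>?S. c U) (\<Sum>U\<in>?S. qvar ^ card U * weak_gf qvar r U)"
      by (rule has_lead_sum)
    then have "has_lead ?t 0 (\<Sum>U\<in>?S. c U) (weak_gf qvar r V * (1 - qvar ^ card V))"
      by (simp only: weak_gf_proper[OF qvar_power_neq_1 psubset(1) False])
    \<comment> \<open>Multiplying by -t^n with t = 1/q turns 1 - q^n into 1 - t^n, which can be
      divided out.\<close>
    from has_lead_mult[OF has_lead_mult[OF has_lead_const[of _ "-1"] has_lead_power[of _ "card V"]] this]
    have "has_lead ?t (card V) (- (\<Sum>U\<in>?S. c U))
        (- (?t ^ card V * (weak_gf qvar r V * (1 - qvar ^ card V))))"
      by simp
    also have "- (?t ^ card V * (weak_gf qvar r V * (1 - qvar ^ card V))) = weak_gf qvar r V * (1 - ?t ^ card V)"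
      by (simp add: power_one_over field_simps)
    finally have "has_lead ?t (card V) (- (\<Sum>U\<in>?S. c U)) (weak_gf qvar r V * (1 - ?t ^ card V))" .
    then have "has_lead ?t (card V) (- (\<Sum>U\<in>?S. c U)) (weak_gf qvar r V)"
      by (rule has_lead_divide_one_minus_power) (simp add: False psubset(1) card_gt_0_iff)
    then show ?thesis ..
  qed
qed

text \<open>Among the summands S(V - T) only T = V contributes at order 0 in 1/q, with value 1;
  dividing by q^|V| - 1 then raises the order by |V|.\<close>

lemma has_lead_inverse_strict_gf:
  assumes "finite V"
  shows "has_lead (1 / qvar) (card V) 1 (strict_gf qvar r V)"
  using assms
proof (induction V rule: finite_psubset_induct)
  case (psubset V)
  show ?case
  proof (cases "V = {}")
    case True
    then show ?thesis by (simp add: strict_gf_empty has_lead_one)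
  next
    case False
    let ?S = "up_sets r V - {{}}" and ?t = "1 / qvar"
    have "has_lead ?t 0 (if T = V then 1 else 0) (strict_gf qvar r (V - T))" if "T \<in> ?S" for T
    proof -
      have T: "T \<subseteq> V" "V - T \<subset> V" using that by (auto dest: up_sets_subset)
      then have "card (V - T) = 0 \<longleftrightarrow> T = V" using psubset(1) by auto
      then show ?thesis
        using has_lead_mono[OF psubset(2)[OF T(2)], of 0] by simp
    qed
    then have "has_lead ?t 0 (\<Sum>T\<in>?S. if T = V then 1 else 0) (\<Sum>T\<in>?S. strict_gf qvar r (V - T))"
      by (rule has_lead_sum)
    moreover have "(\<Sum>T\<in>?S. if T = V then 1 else 0) = (1 :: rat)"
      using False psubset(1) by simp
    ultimately have "has_lead ?t 0 1 (strict_gf qvar r V * (qvar ^ card V - 1))"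
      by (simp only: strict_gf_proper[OF qvar_power_neq_1 psubset(1) False])
    from has_lead_mult[OF has_lead_power[of _ "card V"] this]
    have "has_lead ?t (card V) 1 (strict_gf qvar r V * (1 - ?t ^ card V))"
      by (simp add: power_one_over field_simps)
    then show ?thesis
      by (rule has_lead_divide_one_minus_power) (simp add: False psubset(1) card_gt_0_iff)
  qed
qed

text \<open>The least strictly order-reversing map to the naturals sends u to mc(u) - 1, whence the
  exponent. Positivity of \<open>c\<close> is part of the claim because it is what excludes
  cancellation in the induction and in later sums.\<close>

lemma has_lead_strict_gf:
  assumes "finite U" "antisym r" "trans r" "refl_on U r"
  shows "\<exists>c>0. has_lead qvar (\<Sum>u\<in>U. mc_in r U u - 1) c ((-1) ^ card U * strict_gf qvar r U)"
  using assms(1,4)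
proof (induction U rule: finite_psubset_induct)
  case (psubset U)
  show ?case
  proof (cases "U = {}")
    case True
    then show ?thesis
      by (auto intro!: exI[of _ 1] simp: strict_gf_empty has_lead_one)
  next
    case False
    let ?M = "max_elts r U" and ?n = "\<Sum>u\<in>U. mc_in r U u - 1"
    let ?f = "\<lambda>A. qvar ^ card (U - A) * ((-1) ^ card (U - A) * strict_gf qvar r (U - A))"
    have rfl: "(u, u) \<in> r" if "u \<in> U" for u using that psubset(3) by (simp add: refl_on_def)
    have "?M \<noteq> {}"
      using ex_max_elt_above[OF psubset(1) assms(2,3)] False by blast
    \<comment> \<open>Deleting \<open>A\<close> lowers mc by at most one, and q^|U - A| gives one
      back for each remaining element, so the order is at least \<open>?n\<close>. Deleting all
      maximal elements gives equality, so one term is sure to contribute a positive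
      coefficient.\<close>
    have lead: "\<exists>c\<ge>0. has_lead qvar ?n c (?f A) \<and> (A = ?M \<longrightarrow> c > 0)" if A: "A \<in> Pow ?M - {{}}" for A
    proof -
      have AU: "A \<subseteq> U" "U - A \<subset> U" "refl_on (U - A) r"
        using A max_elts_subset[of r U] psubset(3) by (auto simp: refl_on_def)
      then obtain c where c: "c > 0"
        "has_lead qvar (\<Sum>u\<in>U - A. mc_in r (U - A) u - 1) c ((-1) ^ card (U - A) * strict_gf qvar r (U - A))"
        using psubset.IH by blast
      let ?k = "card (U - A) + (\<Sum>u\<in>U - A. mc_in r (U - A) u - 1)"
      have "?k = (\<Sum>u\<in>U - A. 1 + (mc_in r (U - A) u - 1))"
        by (subst sum.distrib) simp
      also have "\<dots> = (\<Sum>u\<in>U - A. mc_in r (U - A) u)"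
      proof (intro sum.cong refl)
        fix u assume "u \<in> U - A"
        then have "mc_in r (U - A) u > 0"
          using psubset(1) rfl by (intro mc_in_pos) auto
        then show "1 + (mc_in r (U - A) u - 1) = mc_in r (U - A) u" by simp
      qed
      finally have k: "?k = (\<Sum>u\<in>U - A. mc_in r (U - A) u)" .
      have "?n = (\<Sum>u\<in>U - A. mc_in r U u - 1)"
      proof (rule sum.mono_neutral_right)
        show "\<forall>u\<in>U - (U - A). mc_in r U u - 1 = 0"
          using A rfl AU(1) mc_in_max_elt[OF psubset(1), of _ r] by (simp add: subset_iff)
      qed (use psubset(1) in auto)
      moreover have "(\<Sum>u\<in>U - A. mc_in r U u - 1) \<le> (\<Sum>u\<in>U - A. mc_in r (U - A) u)"
      proof (rule sum_mono)
        fix u assume "u \<in> U - A"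
        then show "mc_in r U u - 1 \<le> mc_in r (U - A) u"
          using mc_in_Diff_ge[OF psubset(1), of A r u] A rfl by auto
      qed
      ultimately have le: "?n \<le> ?k" using k by simp
      have eq: "?k = ?n" if "A = ?M"
      proof -
        have "(\<Sum>u\<in>U - A. mc_in r (U - A) u) \<le> (\<Sum>u\<in>U - A. mc_in r U u - 1)"
        proof (rule sum_mono)
          fix u assume "u \<in> U - A"
          then show "mc_in r (U - A) u \<le> mc_in r U u - 1"
            using mc_in_Diff_max_elts[OF psubset(1) assms(2,3) psubset(3), of u] that by auto
        qed
        then show ?thesis using le k \<open>?n = (\<Sum>u\<in>U - A. mc_in r U u - 1)\<close> by simp
      qed
      have "has_lead qvar ?k (1 * c) (?f A)"
        by (intro has_lead_mult has_lead_power c)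
      from has_lead_mono[OF this le] eq c(1) show ?thesis
        by (intro exI[of _ "if ?k = ?n then 1 * c else 0"]) auto
    qed
    then obtain c where c: "c A \<ge> 0" "has_lead qvar ?n (c A) (?f A)" "A = ?M \<longrightarrow> c A > 0"
      if "A \<in> Pow ?M - {{}}" for A
      by metis
    have fin: "finite ?M" using psubset(1) max_elts_subset[of r U] finite_subset by auto
    have pos: "(\<Sum>A\<in>Pow ?M - {{}}. c A) > 0"
      by (rule sum_pos2[of _ ?M]) (use c \<open>?M \<noteq> {}\<close> fin in auto)
    \<comment> \<open>The term for the empty \<open>A\<close> is q^|U| times the unknown itself;
      moved to the left, it produces the factor 1 - q^|U|.\<close>
    have "(-1) ^ card U * strict_gf qvar r U * (1 - qvar ^ card U) = (\<Sum>A\<in>Pow ?M - {{}}. ?f A)"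
    proof -
      have "(-1) ^ card U * strict_gf qvar r U = (\<Sum>A\<in>Pow ?M. ?f A)"
      proof -
        have "(-1) ^ card U * strict_gf qvar r U = (\<Sum>A\<in>Pow ?M.
            (-1) ^ card U * ((-1) ^ card A * (qvar ^ card (U - A) * strict_gf qvar r (U - A))))"
          by (subst strict_gf_antichain_rec[OF qvar_power_neq_1 psubset(1) assms(2,3)])
            (simp_all only: sum_distrib_left)
        also have "\<dots> = (\<Sum>A\<in>Pow ?M. ?f A)"
        proof (intro sum.cong refl)
          fix A assume "A \<in> Pow ?M"
          then have "A \<subseteq> U" using max_elts_subset[of r U] by auto
          then have "card U = card A + card (U - A)"
            using psubset(1) by (simp add: card_Diff_subset finite_subset card_mono)
          then show "(-1) ^ card U * ((-1) ^ card A * (qvar ^ card (U - A) * strict_gf qvar r (U - A))) = ?f A"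
            by (simp add: power_add mult_ac flip: power_mult_distrib)
        qed
        finally show ?thesis .
      qed
      also have "\<dots> = ?f {} + (\<Sum>A\<in>Pow ?M - {{}}. ?f A)"
        using fin by (subst sum.remove[of _ "{}"]) auto
      finally show ?thesis by (simp add: algebra_simps)
    qed
    then have "has_lead qvar ?n (\<Sum>A\<in>Pow ?M - {{}}. c A)
        ((-1) ^ card U * strict_gf qvar r U * (1 - qvar ^ card U))"
      using has_lead_sum[of "Pow ?M - {{}}", OF c(2)] by simp
    then have "has_lead qvar ?n (\<Sum>A\<in>Pow ?M - {{}}. c A) ((-1) ^ card U * strict_gf qvar r U)"
      by (rule has_lead_divide_one_minus_power) (simp add: False psubset(1) card_gt_0_iff)
    then show ?thesis using pos by blast
  qed
qed

section \<open>The q-Ehrhart polynomial\<close>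

text \<open>The coefficient of z^k in the sum over up-sets.\<close>

definition up_coeff :: "('a \<times> 'a) set \<Rightarrow> 'a set \<Rightarrow> nat \<Rightarrow> rat poly fract" where
  "up_coeff r V k =
    (\<Sum>U | U \<in> up_sets r V \<and> card U = k. strict_gf qvar r U * weak_gf qvar r (V - U))"

text \<open>
  The linear factor comes from \<open>q\<^bsup>n+1\<^esup> = q - q (1 - q) [n]\<^sub>q\<close>.
\<close>
definition ehrhart_poly :: "('a \<times> 'a) set \<Rightarrow> 'a set \<Rightarrow> rat poly fract poly" where
  "ehrhart_poly r V = (\<Sum>k\<le>card V. smult (up_coeff r V k) ([:qvar, - (qvar * (1 - qvar)):] ^ k))"

lemma qvar_neq_1 [simp]: "qvar \<noteq> 1"
  using qvar_power_neq_1[of 1] by simp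

lemma qint_eq: "qint (int n) = (1 - qvar ^ n) / (1 - qvar)"
  by (simp add: qint_def)

lemma poly_ehrhart_poly:
  assumes "finite V"
  shows "poly (ehrhart_poly r V) (qint (int n)) = box_gf qvar r V (Suc n)"
proof -
  have "(1 - qvar) * qint (int n) = 1 - qvar ^ n"
    by (simp add: qint_eq)
  moreover have "qvar - qint (int n) * (qvar * (1 - qvar)) = qvar * (1 - (1 - qvar) * qint (int n))"
    by (simp add: algebra_simps)
  ultimately have eval: "qvar - qint (int n) * (qvar * (1 - qvar)) = qvar ^ Suc n"
    by simp
  have "poly (ehrhart_poly r V) (qint (int n)) = (\<Sum>k\<le>card V. up_coeff r V k * (qvar ^ Suc n) ^ k)"
    by (simp add: ehrhart_poly_def poly_sum eval del: power_Suc)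
  also have "\<dots> = (\<Sum>k\<le>card V. \<Sum>U | U \<in> up_sets r V \<and> card U = k.
      (qvar ^ Suc n) ^ card U * strict_gf qvar r U * weak_gf qvar r (V - U))"
    unfolding up_coeff_def sum_distrib_right by (intro sum.cong refl) auto
  also have "\<dots> = box_gf qvar r V (Suc n)"
    unfolding box_gf_def
    by (rule sum.group) (use assms in \<open>auto intro: card_mono dest: up_sets_subset\<close>)
  finally show ?thesis .
qed

section \<open>Lattice points of the dilated order polytope\<close>

lemma dilate_order_polytope_lattice:
  assumes "r \<subseteq> {1..m} \<times> {1..m}"
  shows "dilate n (order_polytope m r) \<inter> zn m = (\<lambda>f i. real (f i)) ` box_maps r {1..m} (Suc n)"
proof (intro equalityI subsetI)
  fix x assume x: "x \<in> dilate n (order_polytope m r) \<inter> zn m"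
  then obtain y where y: "y \<in> order_polytope m r" "x = (\<lambda>i. real n * y i)"
    by (auto simp: dilate_def)
  have bnd: "0 \<le> x i \<and> x i \<le> real n" if "i \<in> {1..m}" for i
    using y that by (auto simp: order_polytope_def mult_left_le)
  have mono: "x i \<le> x j" if "(i, j) \<in> r" for i j
    using y that by (auto simp: order_polytope_def intro!: mult_left_mono)
  have out: "x i = 0" if "i \<notin> {1..m}" for i
    using x that by (auto simp: zn_def rn_def)
  define f where "f i = nat \<lfloor>x i\<rfloor>" for i
  have xf: "x i = real (f i)" for i
  proof (cases "i \<in> {1..m}")
    case True
    then have "x i \<in> \<int>" using x by (auto simp: zn_def)
    then show ?thesis using bnd[OF True] by (auto simp: f_def elim!: Ints_cases)
  qed (simp add: f_def out)
  have "f \<in> box_maps r {1..m} (Suc n)"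
    using bnd mono out unfolding box_maps_def xf by (auto simp: less_Suc_eq_le)
  then show "x \<in> (\<lambda>f i. real (f i)) ` box_maps r {1..m} (Suc n)"
    using xf by (auto simp: image_iff fun_eq_iff)
next
  fix x assume "x \<in> (\<lambda>f i. real (f i)) ` box_maps r {1..m} (Suc n)"
  then obtain f where f: "f \<in> box_maps r {1..m} (Suc n)" and x: "x = (\<lambda>i. real (f i))"
    by auto
  have le: "f i \<le> n" for i
    using f by (cases "i \<in> {1..m}") (auto simp: box_maps_def less_Suc_eq_le)
  \<comment> \<open>For \<open>n = 0\<close> the quotient is 0 by convention, which is harmless
    because \<open>f\<close> is then 0 as well.\<close>
  have "(\<lambda>i. real (f i) / real n) \<in> order_polytope m r"
    using f le assms
    by (auto simp: order_polytope_def rn_def box_maps_def divide_le_eq_1 intro!: divide_right_mono)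
  moreover have "x = (\<lambda>i. real n * (real (f i) / real n))"
    using le x by (auto simp: fun_eq_iff)
  ultimately have "x \<in> dilate n (order_polytope m r)"
    unfolding dilate_def by (intro image_eqI[where x = "\<lambda>i. real (f i) / real n"])
  moreover have "x \<in> zn m"
    using f x by (auto simp: zn_def rn_def box_maps_def)
  ultimately show "x \<in> dilate n (order_polytope m r) \<inter> zn m" by blast
qed

lemma qweight_order_polytope:
  assumes "r \<subseteq> {1..m} \<times> {1..m}"
  shows "qweight m (dilate n (order_polytope m r)) = box_gf qvar r {1..m} (Suc n)"
proof -
  have inj: "inj_on (\<lambda>f i. real (f i)) (box_maps r {1..m} (Suc n))"
    by (auto simp: inj_on_def fun_eq_iff)
  have "qvar powi \<lfloor>\<Sum>i=1..m. real (f i)\<rfloor> = qvar ^ (\<Sum>i=1..m. f i)" for f :: "nat \<Rightarrow> nat"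
  proof -
    have "\<lfloor>\<Sum>i=1..m. real (f i)\<rfloor> = int (\<Sum>i=1..m. f i)"
      by (metis floor_of_nat of_nat_sum)
    then show ?thesis by (simp only: power_int_of_nat)
  qed
  then have "qweight m (dilate n (order_polytope m r))
      = (\<Sum>f\<in>box_maps r {1..m} (Suc n). qvar ^ (\<Sum>i=1..m. f i))"
    unfolding qweight_def dilate_order_polytope_lattice[OF assms] sum.reindex[OF inj] by simp
  then show ?thesis
    by (simp add: box_maps_sum[OF qvar_power_neq_1])
qed

lemma inj_qint: "inj (\<lambda>n. qint (int n))"
  by (auto simp: inj_def qint_eq qvar_power_eq_iff)

text \<open>Uniqueness holds because the points [n]_q are pairwise distinct, so two candidates agree
  infinitely often.\<close>

lemma q_ehrhart_eq:
  assumes "r \<subseteq> {1..m} \<times> {1..m}"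
  shows "q_ehrhart m r = ehrhart_poly r {1..m}"
  unfolding q_ehrhart_def
proof (rule the_equality)
  show "\<forall>n. poly (ehrhart_poly r {1..m}) (qint (int n)) = qweight m (dilate n (order_polytope m r))"
    by (simp add: poly_ehrhart_poly qweight_order_polytope[OF assms])
  fix E assume E: "\<forall>n. poly E (qint (int n)) = qweight m (dilate n (order_polytope m r))"
  have "range (\<lambda>n. qint (int n)) \<subseteq> {x. poly (E - ehrhart_poly r {1..m}) x = 0}"
    using E by (auto simp: poly_ehrhart_poly qweight_order_polytope[OF assms])
  then have "infinite {x. poly (E - ehrhart_poly r {1..m}) x = 0}"
    using range_inj_infinite[OF inj_qint] finite_subset by blast
  then have "E - ehrhart_poly r {1..m} = 0"
    using poly_roots_finite by blast
  then show "E = ehrhart_poly r {1..m}" by simp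
qed

text \<open>Evaluation at [0]_q = 0 leaves only the zero map. This is what later identifies the
  x-free coefficient of the numerator with the denominator.\<close>

lemma coeff_ehrhart_poly_0:
  assumes "finite V"
  shows "coeff (ehrhart_poly r V) 0 = 1"
proof -
  have "coeff (ehrhart_poly r V) 0 = poly (ehrhart_poly r V) (qint (int 0))"
    unfolding qint_eq by (simp add: poly_0_coeff_0)
  also have "\<dots> = (\<Sum>f\<in>box_maps r V (Suc 0). qvar ^ (\<Sum>i\<in>V. f i))"
    using assms by (simp only: poly_ehrhart_poly box_maps_sum[OF qvar_power_neq_1])
  also have "box_maps r V (Suc 0) = {\<lambda>_. 0}"
    by (auto simp: box_maps_def fun_eq_iff)
  finally show ?thesis by simp
qed

lemma coeff_linear_power:
  fixes a b :: "'a::comm_semiring_1"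
  shows "coeff ([:a, b:] ^ n) i = of_nat (n choose i) * b ^ i * a ^ (n - i)"
proof (cases "i \<le> n")
  case False
  then have "coeff ([:a, b:] ^ n) i = 0"
    using degree_power_le[of "[:a, b:]" n] degree_pCons_le[of a "[:b:]"]
    by (intro coeff_eq_0) (simp split: if_splits)
  then show ?thesis using False by (simp add: binomial_eq_0)
qed (rule coeff_linear_poly_power)

lemma coeff_ehrhart_poly:
  "coeff (ehrhart_poly r V) j = (\<Sum>k\<le>card V. up_coeff r V k *
     (of_nat (k choose j) * (- (qvar * (1 - qvar))) ^ j * qvar ^ (k - j)))"
  by (simp add: ehrhart_poly_def coeff_sum coeff_linear_power)

lemma degree_ehrhart_poly: "degree (ehrhart_poly r V) \<le> card V"
  by (rule degree_le) (simp add: coeff_ehrhart_poly binomial_eq_0)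

section \<open>Up-sets of minimal weight\<close>

text \<open>The parts outside the intersection have equal size and are separated by the threshold
  \<open>c\<close>.\<close>

lemma sum_threshold_le:
  fixes f :: "'a \<Rightarrow> nat"
  assumes "finite A" "finite B" "card A = card B"
    and "\<And>x. x \<in> A \<Longrightarrow> f x \<le> c" "\<And>x. x \<in> B - A \<Longrightarrow> c \<le> f x"
  shows "sum f A \<le> sum f B"
proof -
  have "card (A - B) = card (B - A)"
    using assms(1-3) by (intro antisym card_le_sym_Diff) simp_all
  moreover have "sum f (A - B) \<le> card (A - B) * c" "card (B - A) * c \<le> sum f (B - A)"
    using assms by (auto intro: sum_bounded_above[of "A - B" f c, simplified] sum_bounded_below[of "B - A" c f, simplified])
  ultimately have "sum f (A - B) \<le> sum f (B - A)" by simp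
  then show ?thesis
    using sum.Int_Diff[OF assms(1), of f B] sum.Int_Diff[OF assms(2), of f A]
    by (simp add: Int_commute)
qed

lemma sorted_sum_min:
  fixes f :: "'a::linorder \<Rightarrow> nat"
  assumes V: "finite V" and s: "sorted as" "mset as = image_mset f (mset_set V)" and k: "k \<le> card V"
  shows "\<exists>S\<subseteq>V. card S = k \<and> sum f S = sum_list (take k as) \<and> (\<forall>u\<in>S. \<forall>v\<in>V - S. f u \<le> f v)"
proof -
  define xs where "xs = sort_key f (sorted_list_of_set V)"
  have xs: "distinct xs" "set xs = V" "sorted (map f xs)"
    using V by (simp_all add: xs_def)
  have "mset (map f xs) = mset as"
    using s(2) V by (simp add: xs_def flip: sorted_list_of_mset_set)
  then have as: "as = map f xs"
    using s(1) xs(3) by (metis properties_for_sort)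
  have len: "length xs = card V" using xs distinct_card by force
  let ?S = "set (take k xs)"
  have "card ?S = k"
    using distinct_card[of "take k xs"] xs(1) len k by simp
  moreover have "sum f ?S = sum_list (take k as)"
    using xs(1) by (simp add: as take_map sum_list_distinct_conv_sum_set)
  moreover have "V - ?S \<subseteq> set (drop k xs)"
    using xs(2) set_append[of "take k xs" "drop k xs"] by auto
  then have "\<forall>u\<in>?S. \<forall>v\<in>V - ?S. f u \<le> f v"
    using xs(3) sorted_append[of "map f (take k xs)" "map f (drop k xs)"]
    by (auto simp flip: map_append)
  moreover have "?S \<subseteq> V" using xs(2) set_take_subset[of k xs] by auto
  ultimately show ?thesis by blast
qed

text \<open>Choose k elements of smallest chain length, ties broken arbitrarily. An element above a
  chosen one has strictly smaller chain length, so it is chosen too.\<close>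

lemma min_weight_up_set:
  fixes r :: "('a::linorder \<times> 'a) set"
  assumes V: "finite V" and r: "partial_order_on V r" and k: "k \<le> card V"
    and s: "sorted as" "mset as = image_mset (mc_in r V) (mset_set V)"
  shows "\<exists>U\<in>up_sets r V. card U = k \<and> (\<Sum>u\<in>U. mc_in r V u) = sum_list (take k as)"
    and "\<And>U. U \<subseteq> V \<Longrightarrow> card U = k \<Longrightarrow> sum_list (take k as) \<le> (\<Sum>u\<in>U. mc_in r V u)"
proof -
  note r = partial_order_onD[OF r]
  obtain S where S: "S \<subseteq> V" "card S = k" "(\<Sum>u\<in>S. mc_in r V u) = sum_list (take k as)"
      "\<And>u v. u \<in> S \<Longrightarrow> v \<in> V - S \<Longrightarrow> mc_in r V u \<le> mc_in r V v"
    using sorted_sum_min[OF V s k] by blast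
  have "v \<in> S" if uv: "u \<in> S" "v \<in> V" "(u, v) \<in> r" for u v
  proof (rule ccontr)
    assume v: "v \<notin> S"
    then have "mc_in r V v < mc_in r V u"
      using uv S(1) r by (intro mc_in_less[OF V]) (auto simp: refl_on_def)
    then show False using S(4)[of u v] uv v by auto
  qed
  then have "S \<in> up_sets r V" using S(1) by (auto simp: up_sets_def)
  then show "\<exists>U\<in>up_sets r V. card U = k \<and> (\<Sum>u\<in>U. mc_in r V u) = sum_list (take k as)"
    using S by blast
  fix U assume U: "U \<subseteq> V" "card U = k"
  have fin: "finite S" "finite U" using S(1) U(1) V finite_subset by auto
  have "(\<Sum>u\<in>S. mc_in r V u) \<le> (\<Sum>u\<in>U. mc_in r V u)"
  proof (cases "S = {}")
    case False
    let ?c = "Max (mc_in r V ` S)"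
    have "?c \<in> mc_in r V ` S" using fin False by (intro Max_in) auto
    then have "?c \<le> mc_in r V v" if "v \<in> U - S" for v
      using that S(4) U(1) by fastforce
    then show ?thesis
      using fin S(2) U(2) by (intro sum_threshold_le[where c = ?c]) auto
  qed simp
  then show "sum_list (take k as) \<le> (\<Sum>u\<in>U. mc_in r V u)" using S(3) by simp
qed

section \<open>Leading terms of the coefficients\<close>

lemma has_lead_one_minus_power_power: "has_lead t 0 1 ((1 - t) ^ n)"
proof (induction n)
  case (Suc n)
  then show ?case
    using has_lead_mult[OF has_lead_one_minus_power[of 1 t] Suc] by simp
qed (simp add: has_lead_one)

text \<open>For fixed k the sign (-1)^|U| is the same for all summands, so the positive coefficients
  from \<open>has_lead_strict_gf\<close> add up.\<close>

lemma has_lead_up_coeff: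
  fixes r :: "('a::linorder \<times> 'a) set"
  assumes V: "finite V" and r: "partial_order_on V r" and k: "k \<le> card V"
    and s: "sorted as" "mset as = image_mset (mc_in r V) (mset_set V)"
  shows "\<exists>c\<noteq>0. has_lead qvar (sum_list (take k as)) c (qvar ^ k * up_coeff r V k)"
proof -
  note ro = partial_order_onD[OF r]
  let ?w = "\<lambda>U. \<Sum>u\<in>U. mc_in r V u" and ?a = "sum_list (take k as)"
  let ?S = "{U. U \<in> up_sets r V \<and> card U = k}"
  let ?f = "\<lambda>U. qvar ^ k * ((-1) ^ k * (strict_gf qvar r U * weak_gf qvar r (V - U)))"
  have lead: "\<exists>c\<ge>0. has_lead qvar ?a c (?f U) \<and> (?w U = ?a \<longrightarrow> c > 0)" if U: "U \<in> ?S" for U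
  proof -
    have UV: "U \<subseteq> V" "finite U" using U V by (auto dest: up_sets_subset up_sets_finite)
    have pos: "mc_in r V u > 0" if "u \<in> U" for u
      using that V UV(1) ro(1) by (intro mc_in_pos) (auto simp: refl_on_def)
    have "refl_on U r" using UV(1) ro(1) by (auto simp: refl_on_def)
    then obtain c where c: "c > 0"
      "has_lead qvar (\<Sum>u\<in>U. mc_in r U u - 1) c ((-1) ^ card U * strict_gf qvar r U)"
      using has_lead_strict_gf[OF UV(2) ro(3,2)] by blast
    \<comment> \<open>The factor q^k contributes 1 for each of the k elements of \<open>U\<close>,
      turning mc - 1 into mc.\<close>
    have "k + (\<Sum>u\<in>U. mc_in r U u - 1) = (\<Sum>u\<in>U. 1 + (mc_in r V u - 1))"
      using U mc_in_up_set[of U r V] by (subst sum.distrib) simp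
    also have "\<dots> = ?w U"
      using pos by (intro sum.cong) auto
    finally have w: "k + (\<Sum>u\<in>U. mc_in r U u - 1) = ?w U" .
    have "has_lead qvar (k + ((\<Sum>u\<in>U. mc_in r U u - 1) + 0)) (1 * (c * 1))
        (qvar ^ k * (((-1) ^ card U * strict_gf qvar r U) * weak_gf qvar r (V - U)))"
      using V by (intro has_lead_mult has_lead_power c has_lead_weak_gf) simp
    then have "has_lead qvar (?w U) c (?f U)"
      using U w by (simp add: mult.assoc)
    from has_lead_mono[OF this min_weight_up_set(2)[OF V r k s UV(1)]] U c(1) show ?thesis
      by (intro exI[of _ "if ?w U = ?a then c else 0"]) auto
  qed
  then have "\<forall>U\<in>?S. \<exists>c\<ge>0. has_lead qvar ?a c (?f U) \<and> (?w U = ?a \<longrightarrow> c > 0)"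
    by (intro ballI)
  from bchoice[OF this] obtain c where c: "\<And>U. U \<in> ?S \<Longrightarrow> c U \<ge> 0"
      "\<And>U. U \<in> ?S \<Longrightarrow> has_lead qvar ?a (c U) (?f U)" "\<And>U. U \<in> ?S \<Longrightarrow> ?w U = ?a \<longrightarrow> c U > 0"
    by blast
  obtain U where U: "U \<in> ?S" "?w U = ?a"
    using min_weight_up_set(1)[OF V r k s] by blast
  have "finite ?S" using V by simp
  then have pos: "(\<Sum>U\<in>?S. c U) > 0"
    using c U by (intro sum_pos2[of _ U]) auto
  have "has_lead qvar ?a (\<Sum>U\<in>?S. c U) (\<Sum>U\<in>?S. ?f U)"
    by (rule has_lead_sum) (rule c)
  also have "(\<Sum>U\<in>?S. ?f U) = (-1) ^ k * (qvar ^ k * up_coeff r V k)"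
    unfolding up_coeff_def sum_distrib_left by (intro sum.cong refl) (simp only: mult_ac)
  \<comment> \<open>A second sign cancels the one inserted to make the coefficients
    nonnegative.\<close>
  finally have "has_lead qvar (0 + ?a) ((-1) ^ k * (\<Sum>U\<in>?S. c U))
      ((-1) ^ k * ((-1) ^ k * (qvar ^ k * up_coeff r V k)))"
    by (intro has_lead_mult has_lead_minus_one_power)
  then have "has_lead qvar ?a ((-1) ^ k * (\<Sum>U\<in>?S. c U)) (qvar ^ k * up_coeff r V k)"
    by (simp flip: mult.assoc power_mult_distrib)
  then show ?thesis using pos by (intro exI[of _ "(-1) ^ k * (\<Sum>U\<in>?S. c U)"]) auto
qed

text \<open>In 1/q, S(U) has order |U| and G(V - U) has order at least |V - U|, so each product has
  order at least |V|, enough to absorb q^k.\<close>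

lemma has_lead_inverse_up_coeff:
  assumes V: "finite V" and k: "k \<le> card V"
  shows "\<exists>c. has_lead (1 / qvar) 0 c (qvar ^ k * up_coeff r V k)"
proof -
  let ?S = "{U. U \<in> up_sets r V \<and> card U = k}" and ?t = "1 / qvar"
  have "\<exists>c. has_lead ?t (card V) c (strict_gf qvar r U * weak_gf qvar r (V - U))" if U: "U \<in> ?S" for U
  proof -
    have UV: "U \<subseteq> V" "finite U" using U V by (auto dest: up_sets_subset up_sets_finite)
    obtain c where "has_lead ?t (card (V - U)) c (weak_gf qvar r (V - U))"
      using has_lead_inverse_weak_gf[of "V - U" r] V by blast
    from has_lead_mult[OF has_lead_inverse_strict_gf[OF UV(2)] this]
    have "has_lead ?t (card U + card (V - U)) c (strict_gf qvar r U * weak_gf qvar r (V - U))"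
      by simp
    moreover have "card U + card (V - U) = card V"
      using UV V by (simp add: card_Diff_subset card_mono)
    ultimately show ?thesis by auto
  qed
  then have "\<forall>U\<in>?S. \<exists>c. has_lead ?t (card V) c (strict_gf qvar r U * weak_gf qvar r (V - U))"
    by (intro ballI)
  from bchoice[OF this] obtain c
    where "\<And>U. U \<in> ?S \<Longrightarrow> has_lead ?t (card V) (c U) (strict_gf qvar r U * weak_gf qvar r (V - U))"
    by blast
  then have "has_lead ?t (card V) (\<Sum>U\<in>?S. c U) (up_coeff r V k)"
    unfolding up_coeff_def by (rule has_lead_sum)
  from has_lead_mono[OF this k] obtain c' where "has_lead ?t k c' (up_coeff r V k)"
    by blast
  then have "has_lead ?t 0 c' (qvar ^ k * up_coeff r V k)"
    using has_lead_cancel_power[of ?t 0 k c' "qvar ^ k * up_coeff r V k"] by (simp add: power_one_over)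
  then show ?thesis ..
qed

lemma up_coeff_card:
  assumes "finite V"
  shows "up_coeff r V (card V) = strict_gf qvar r V"
proof -
  have "{U. U \<in> up_sets r V \<and> card U = card V} = {V}"
    using card_subset_eq[OF assms up_sets_subset] by auto
  then show ?thesis by (simp add: up_coeff_def)
qed

text \<open>Regrouped so that q^k stands beside \<open>up_coeff r V k\<close>, the product whose
  orders are known; below k = j the binomial coefficient is 0.\<close>

lemma coeff_ehrhart_poly':
  "coeff (ehrhart_poly r V) j = (\<Sum>k\<in>{j..card V}.
     (-1) ^ j * of_nat (k choose j) * (1 - qvar) ^ j * (qvar ^ k * up_coeff r V k))"
proof -
  have "coeff (ehrhart_poly r V) j = (\<Sum>k\<in>{j..card V}. up_coeff r V k *
     (of_nat (k choose j) * (- (qvar * (1 - qvar))) ^ j * qvar ^ (k - j)))"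
    unfolding coeff_ehrhart_poly
    by (rule sum.mono_neutral_right) (auto simp: binomial_eq_0 not_le)
  also have "\<dots> = (\<Sum>k\<in>{j..card V}.
     (-1) ^ j * of_nat (k choose j) * (1 - qvar) ^ j * (qvar ^ k * up_coeff r V k))"
  proof (intro sum.cong refl)
    fix k assume "k \<in> {j..card V}"
    then have "qvar ^ k = qvar ^ j * qvar ^ (k - j)" by (simp flip: power_add)
    moreover have "(- (qvar * (1 - qvar))) ^ j = (-1) ^ j * qvar ^ j * (1 - qvar) ^ j"
      by (metis mult_minus1 power_mult_distrib mult.assoc)
    ultimately show "up_coeff r V k * (of_nat (k choose j) * (- (qvar * (1 - qvar))) ^ j * qvar ^ (k - j))
        = (-1) ^ j * of_nat (k choose j) * (1 - qvar) ^ j * (qvar ^ k * up_coeff r V k)"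
      by (simp only: mult_ac)
  qed
  finally show ?thesis .
qed

text \<open>All entries of \<open>as\<close> are positive, so their partial sums grow strictly and
  only k = j, with binomial coefficient 1, reaches the lowest order.\<close>

lemma has_lead_coeff_ehrhart_poly:
  fixes r :: "('a::linorder \<times> 'a) set"
  assumes V: "finite V" and r: "partial_order_on V r" and j: "j \<le> card V"
    and s: "sorted as" "mset as = image_mset (mc_in r V) (mset_set V)"
  shows "\<exists>c\<noteq>0. has_lead qvar (sum_list (take j as)) c (coeff (ehrhart_poly r V) j)"
proof -
  let ?a = "\<lambda>k. sum_list (take k as)"
  let ?f = "\<lambda>k. (-1) ^ j * of_nat (k choose j) * (1 - qvar) ^ j * (qvar ^ k * up_coeff r V k)"
  have len: "length as = card V"
    using arg_cong[OF s(2), of size] by simp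
  have pos: "x > 0" if "x \<in> set as" for x
  proof -
    have "x \<in># image_mset (mc_in r V) (mset_set V)"
      using that by (simp flip: s(2))
    then obtain v where "v \<in> V" "x = mc_in r V v" using V by auto
    then show ?thesis
      using V partial_order_onD(1)[OF r] by (auto intro!: mc_in_pos simp: refl_on_def)
  qed
  have less: "?a j < ?a k" if "j < k" "k \<le> card V" for k
  proof -
    have "take k as = take j as @ drop j (take k as)"
      using that(1) append_take_drop_id[of j "take k as"] by (simp add: min_def)
    moreover have "drop j (take k as) \<noteq> []" using that len by simp
    then obtain x xs where x: "drop j (take k as) = x # xs" by (cases "drop j (take k as)") auto
    then have "x \<in> set as"
      by (metis in_set_dropD in_set_takeD list.set_intros(1))
    ultimately show ?thesis using pos[of x] x by (metis add_gr_0 less_add_same_cancel1 sum_list.Cons sum_list_append)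
  qed
  have "\<exists>c. has_lead qvar (?a j) c (?f k) \<and> (c = 0 \<longleftrightarrow> k \<noteq> j)" if k: "k \<in> {j..card V}" for k
  proof -
    obtain c where c: "c \<noteq> 0" "has_lead qvar (?a k) c (qvar ^ k * up_coeff r V k)"
      using has_lead_up_coeff[OF V r _ s, of k] k by auto
    have "has_lead qvar (0 + 0 + 0 + ?a k) ((-1) ^ j * of_nat (k choose j) * 1 * c) (?f k)"
      by (intro has_lead_mult has_lead_minus_one_power has_lead_of_nat
          has_lead_one_minus_power_power c)
    then have "has_lead qvar (?a k) ((-1) ^ j * of_nat (k choose j) * c) (?f k)"
      by simp
    then have "has_lead qvar (?a j) (if ?a k = ?a j then (-1) ^ j * of_nat (k choose j) * c else 0) (?f k)"
      using less[of k] k by (intro has_lead_mono) (cases "j = k"; auto)+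
    moreover have "?a k = ?a j \<longleftrightarrow> k = j" using less[of k] k by (cases "j = k") auto
    ultimately show ?thesis using c(1) by (intro exI conjI) auto
  qed
  then have "\<forall>k\<in>{j..card V}. \<exists>c. has_lead qvar (?a j) c (?f k) \<and> (c = 0 \<longleftrightarrow> k \<noteq> j)"
    by (intro ballI)
  from bchoice[OF this] obtain c where c: "\<And>k. k \<in> {j..card V} \<Longrightarrow> has_lead qvar (?a j) (c k) (?f k)"
      "\<And>k. k \<in> {j..card V} \<Longrightarrow> c k = 0 \<longleftrightarrow> k \<noteq> j"
    by blast
  have "has_lead qvar (?a j) (\<Sum>k\<in>{j..card V}. c k) (coeff (ehrhart_poly r V) j)"
    unfolding coeff_ehrhart_poly' by (rule has_lead_sum) (rule c)
  moreover have "(\<Sum>k\<in>{j..card V}. c k) = c j"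
    using c(2) j by (subst sum.remove[of _ j]) (auto intro: sum.neutral)
  ultimately show ?thesis using c(2)[of j] j by auto
qed

text \<open>The degree j comes from (1 - q)^j alone. For j = |V| only k = j is left, and there the
  leading coefficient of S(V) in 1/q is known to be 1, so the degree is exact.\<close>

lemma has_lead_inverse_coeff_ehrhart_poly:
  assumes V: "finite V"
  shows "\<exists>c. has_lead (1 / qvar) 0 c ((1 / qvar) ^ j * coeff (ehrhart_poly r V) j)"
    and "has_lead (1 / qvar) 0 1 ((1 / qvar) ^ card V * coeff (ehrhart_poly r V) (card V))"
proof -
  let ?t = "1 / qvar"
  \<comment> \<open>The sign combines with (1 - q)^j / q^j to give (1 - 1/q)^j, which has constant
    term 1 in 1/q.\<close>
  have flip: "?t ^ j * ((-1) ^ j * x * (1 - qvar) ^ j * y) = x * (1 - ?t) ^ j * y" for x y j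
  proof -
    have "?t ^ j * (-1) ^ j * (1 - qvar) ^ j = (1 - ?t) ^ j"
      by (simp add: field_simps flip: power_mult_distrib)
    then show ?thesis by (metis (no_types, lifting) mult.assoc mult.left_commute)
  qed
  have coeff: "?t ^ j * coeff (ehrhart_poly r V) j =
      (\<Sum>k\<in>{j..card V}. of_nat (k choose j) * (1 - ?t) ^ j * (qvar ^ k * up_coeff r V k))" for j
    unfolding coeff_ehrhart_poly' sum_distrib_left flip ..
  have "\<exists>c. has_lead ?t 0 c (of_nat (k choose j) * (1 - ?t) ^ j * (qvar ^ k * up_coeff r V k))"
    if k: "k \<in> {j..card V}" for k
  proof -
    obtain c where "has_lead ?t 0 c (qvar ^ k * up_coeff r V k)"
      using has_lead_inverse_up_coeff[OF V, of k r] k by auto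
    then have "has_lead ?t (0 + 0 + 0) (of_nat (k choose j) * 1 * c)
        (of_nat (k choose j) * (1 - ?t) ^ j * (qvar ^ k * up_coeff r V k))"
      by (intro has_lead_mult has_lead_of_nat has_lead_one_minus_power_power)
    then show ?thesis by auto
  qed
  then have "\<forall>k\<in>{j..card V}. \<exists>c. has_lead ?t 0 c (of_nat (k choose j) * (1 - ?t) ^ j * (qvar ^ k * up_coeff r V k))"
    by (intro ballI)
  from bchoice[OF this] obtain c where "\<And>k. k \<in> {j..card V} \<Longrightarrow>
      has_lead ?t 0 (c k) (of_nat (k choose j) * (1 - ?t) ^ j * (qvar ^ k * up_coeff r V k))"
    by blast
  then show "\<exists>c. has_lead ?t 0 c (?t ^ j * coeff (ehrhart_poly r V) j)"
    unfolding coeff by (intro exI) (rule has_lead_sum)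
  have "has_lead ?t (card V) 1 (up_coeff r V (card V))"
    unfolding up_coeff_card[OF V] by (rule has_lead_inverse_strict_gf[OF V])
  then have "has_lead ?t 0 1 (qvar ^ card V * up_coeff r V (card V))"
    using has_lead_cancel_power[of ?t 0 "card V" 1 "qvar ^ card V * up_coeff r V (card V)"]
    by (simp add: power_one_over)
  from has_lead_mult[OF has_lead_one_minus_power_power this]
  show "has_lead ?t 0 1 (?t ^ card V * coeff (ehrhart_poly r V) (card V))"
    unfolding coeff by simp
qed

section \<open>The numerator\<close>

lemma of_int_poly_q_simps [simp]:
  "of_int_poly_q 0 = 0" "of_int_poly_q 1 = 1"
  "of_int_poly_q (p + p') = of_int_poly_q p + of_int_poly_q p'"
  "of_int_poly_q (p * p') = of_int_poly_q p * of_int_poly_q p'"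
  by (simp_all add: of_int_poly_q_def map_poly_add_hom map_poly_mult_hom)

lemma of_int_poly_q_minus [simp]: "of_int_poly_q (- p) = - of_int_poly_q p"
  using of_int_poly_q_simps(3)[of p "- p"] by (simp add: eq_neg_iff_add_eq_0 add.commute)

lemma of_int_poly_q_eq_iff [simp]: "of_int_poly_q p = of_int_poly_q p' \<longleftrightarrow> p = p'"
  by (auto simp: of_int_poly_q_def poly_eq_iff coeff_map_poly)

lemma of_int_poly_q_eq_0_iff [simp]: "of_int_poly_q p = 0 \<longleftrightarrow> p = 0"
  using of_int_poly_q_eq_iff[of p 0] by simp

text \<open>Stated for a general multiplicative \<open>f\<close> because it is applied twice: to the
  integers inside the rationals, and to \<int>[q] inside \<rat>(q).\<close>

lemma clear_denominators:
  fixes f :: "'a::idom \<Rightarrow> 'b::field"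
  assumes f: "f 0 = 0" "f 1 = 1" "\<And>a b. f (a * b) = f a * f b"
    and frac: "\<And>x. \<exists>a b. f b \<noteq> 0 \<and> f b * x = f a"
  shows "\<exists>d N. f d \<noteq> 0 \<and> smult (f d) p = map_poly f N"
proof (induction p)
  case 0
  show ?case using f by (intro exI[of _ 1] exI[of _ 0]) simp
next
  case (pCons x p)
  obtain d N where dN: "f d \<noteq> 0" "smult (f d) p = map_poly f N" using pCons by blast
  obtain a b where ab: "f b \<noteq> 0" "f b * x = f a" using frac by blast
  have "map_poly f (smult b N) = smult (f b) (map_poly f N)"
    by (rule poly_eqI) (simp add: coeff_map_poly f)
  then have "smult (f (d * b)) (pCons x p) = pCons (f (d * a)) (map_poly f (smult b N))"
    using ab dN(2)[symmetric] by (simp add: f mult.assoc mult.commute)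
  also have "\<dots> = map_poly f (pCons (d * a) (smult b N))"
    by (rule poly_eqI) (simp add: coeff_map_poly f coeff_pCons split: nat.split)
  finally show ?case using ab dN f by (intro exI[of _ "d * b"] exI) auto
qed

lemma ex_of_int_poly_q_fraction: "\<exists>a b. of_int_poly_q b \<noteq> 0 \<and> of_int_poly_q b * x = of_int_poly_q a"
proof -
  have rat: "\<exists>d N. (of_int d :: rat) \<noteq> 0 \<and> smult (of_int d) p = map_poly of_int N" for p :: "rat poly"
  proof (rule clear_denominators)
    fix x :: rat
    obtain a b where "b > 0" "x = of_int a / of_int b"
      by (metis quotient_of_denom_pos quotient_of_div surj_pair)
    then show "\<exists>a b. (of_int b :: rat) \<noteq> 0 \<and> of_int b * x = of_int a"
      by (intro exI[of _ a] exI[of _ b]) simp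
  qed simp_all
  obtain n d where nd: "x = to_fract n / to_fract d" "d \<noteq> 0"
    by (cases x) (auto simp: Fract_conv_to_fract)
  obtain a N where aN: "(of_int a :: rat) \<noteq> 0" "smult (of_int a) n = map_poly of_int N"
    using rat by blast
  obtain b M where bM: "(of_int b :: rat) \<noteq> 0" "smult (of_int b) d = map_poly of_int M"
    using rat by blast
  have c: "of_int_poly_q [:c:] = to_fract [:of_int c:]" for c
    by (simp add: of_int_poly_q_def map_poly_pCons)
  have *: "of_int_poly_q N = to_fract [:of_int a:] * to_fract n"
    "of_int_poly_q M = to_fract [:of_int b:] * to_fract d"
    by (simp_all add: of_int_poly_q_def flip: aN bM to_fract_mult)
  have "of_int_poly_q ([:a:] * M) * x = of_int_poly_q ([:b:] * N)"
    using nd by (simp only: of_int_poly_q_simps * c) simp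
  moreover have "of_int_poly_q ([:a:] * M) \<noteq> 0"
    using nd(2) aN(1) bM(1) by (simp only: of_int_poly_q_simps * c) simp
  ultimately show ?thesis by blast
qed

lemma map_poly_of_int_poly_q_smult:
  "map_poly of_int_poly_q (smult a N) = smult (of_int_poly_q a) (map_poly of_int_poly_q N)"
  by (rule poly_eqI) (simp add: coeff_map_poly)

lemma map_poly_of_int_poly_q_eq_iff:
  "map_poly of_int_poly_q N = map_poly of_int_poly_q N' \<longleftrightarrow> N = N'"
  by (auto simp: poly_eq_iff coeff_map_poly)

lemma smult_of_int_poly_q_inverse:
  assumes "D \<noteq> 0"
  shows "E = smult (1 / of_int_poly_q D) P \<longleftrightarrow> smult (of_int_poly_q D) E = P"
  using assms by auto

lemma smult_cancel:
  fixes c :: "'a::idom"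
  assumes "c \<noteq> 0"
  shows "smult c p = smult c p' \<longleftrightarrow> p = p'"
  using assms by (auto simp: poly_eq_iff)

text \<open>Cross-multiplying gives D' N = D N'. Coprimality in \<int>[q,x] makes N and N' divide
  each other, and the positive leading coefficients exclude the unit -1.\<close>

lemma coprime_fraction_unique:
  assumes "smult (of_int_poly_q D) E = map_poly of_int_poly_q N" "gcd N [:D:] = 1"
    and "smult (of_int_poly_q D') E = map_poly of_int_poly_q N'" "gcd N' [:D':] = 1"
    and "lead_coeff (lead_coeff N) > 0" "lead_coeff (lead_coeff N') > 0"
  shows "N = N'"
proof -
  have "map_poly of_int_poly_q (smult D' N) = map_poly of_int_poly_q (smult D N')"
    unfolding map_poly_of_int_poly_q_smult
    by (simp add: mult.commute flip: assms(1,3))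
  then have "[:D':] * N = [:D:] * N'"
    by (simp add: map_poly_of_int_poly_q_eq_iff)
  then have "N dvd [:D:] * N'" "N' dvd [:D':] * N"
    by (metis dvd_triv_right)+
  moreover have "coprime N [:D:]" "coprime N' [:D':]"
    using assms(2,4) by (simp_all add: coprime_iff_gcd_eq_1)
  ultimately have "N dvd N'" "N' dvd N"
    by (metis coprime_dvd_mult_right_iff)+
  then have "normalize N = normalize N'" by (rule associatedI)
  moreover have "normalize M = M" if "lead_coeff (lead_coeff M) > 0" for M :: "int poly poly"
    using that by (intro unit_factor_1_imp_normalized) (simp add: unit_factor_poly_def one_pCons)
  ultimately show ?thesis using assms(5,6) by metis
qed

lemma ex_coprime_fraction:
  assumes "E \<noteq> 0"
  shows "\<exists>N D. D \<noteq> 0 \<and> smult (of_int_poly_q D) E = map_poly of_int_poly_q N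
           \<and> gcd N [:D:] = 1 \<and> lead_coeff (lead_coeff N) > 0"
proof -
  obtain D N where DN: "D \<noteq> 0" "smult (of_int_poly_q D) E = map_poly of_int_poly_q N"
    using clear_denominators[of of_int_poly_q E] ex_of_int_poly_q_fraction by auto
  let ?g = "gcd N [:D:]"
  have g: "?g \<noteq> 0" using DN(1) by simp
  then obtain N' d where red: "N = N' * ?g" "[:D:] = d * ?g" "coprime N' d"
    using gcd_coprime_exists by blast
  \<comment> \<open>The gcd divides a polynomial that is constant in x, so the cancelled denominator
    stays in \<int>[q].\<close>
  have "degree d + degree ?g = 0"
    using red(2) DN(1) g by (metis degree_mult_eq degree_pCons_0 mult_eq_0_iff pCons_eq_0_iff)
  then obtain D' g0 where g0: "d = [:D':]" "?g = [:g0:]"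
    by (metis add_is_0 degree_0_id degree_eq_zeroE)
  then have D: "D = g0 * D'" "D' \<noteq> 0" "g0 \<noteq> 0" and N: "N = smult g0 N'"
    using red(1,2) DN(1) by (simp_all add: mult.commute)
  have g0_nz: "of_int_poly_q g0 \<noteq> 0" using D(3) by simp
  have "smult (of_int_poly_q g0) (smult (of_int_poly_q D') E)
      = smult (of_int_poly_q g0) (map_poly of_int_poly_q N')"
    using DN(2) unfolding D(1) N map_poly_of_int_poly_q_smult by simp
  then have frac: "smult (of_int_poly_q D') E = map_poly of_int_poly_q N'"
    by (simp only: smult_cancel[OF g0_nz])
  then have "N' \<noteq> 0" using assms D(2) by auto
  have cop: "gcd N' [:D':] = 1" using red(3) unfolding g0(1) by (rule coprime_imp_gcd_eq_1)
  show ?thesis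
  proof (cases "lead_coeff (lead_coeff N') > 0")
    case True
    then show ?thesis using frac cop D(2) by (intro exI[of _ N'] exI[of _ D']) (intro conjI)
  next
    case False
    moreover have "lead_coeff (lead_coeff N') \<noteq> 0"
      using \<open>N' \<noteq> 0\<close> by simp
    ultimately have "lead_coeff (lead_coeff N') < 0"
      by linarith
    then have "lead_coeff (lead_coeff (- N')) > 0"
      by simp
    moreover have "smult (of_int_poly_q (- D')) E = map_poly of_int_poly_q (- N')"
      using arg_cong[OF frac, of uminus] by (simp add: poly_eq_iff coeff_map_poly)
    moreover have "gcd (- N') [:- D':] = 1"
    proof -
      have "[:- D':] = - [:D':]" by simp
      then show ?thesis using cop by (simp only: gcd_neg1 gcd_neg2)
    qed
    ultimately show ?thesis using D(2) by (intro exI[of _ "- N'"] exI[of _ "- D'"]) simp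
  qed
qed

lemma numerator_properties:
  assumes "E \<noteq> 0"
  shows "\<exists>D. D \<noteq> 0 \<and> smult (of_int_poly_q D) E = map_poly of_int_poly_q (numerator E)
           \<and> gcd (numerator E) [:D:] = 1"
proof -
  let ?P = "\<lambda>N. lead_coeff (lead_coeff N) > 0 \<and> (\<exists>D. D \<noteq> 0 \<and>
      E = smult (1 / of_int_poly_q D) (map_poly of_int_poly_q N) \<and> gcd N [:D:] = 1)"
  have "\<exists>!N. ?P N"
  proof (rule ex_ex1I)
    show "\<exists>N. ?P N"
      using ex_coprime_fraction[OF assms] smult_of_int_poly_q_inverse by metis
    fix N N' assume "?P N" "?P N'"
    then show "N = N'"
      using coprime_fraction_unique smult_of_int_poly_q_inverse by metis
  qed
  then have "?P (numerator E)"
    unfolding numerator_def by (rule theI')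
  then show ?thesis using smult_of_int_poly_q_inverse by metis
qed

section \<open>Newton polygons\<close>

lemma to_fract_pCons: "to_fract (pCons a p) = const_fract a + to_fract (monom 1 1) * to_fract p"
proof -
  have "pCons a p = [:a:] + monom 1 1 * p"
    by (simp add: monom_altdef)
  then show ?thesis by (simp only: to_fract_add to_fract_mult const_fract_def)
qed

lemma peval_qvar: "peval qvar p = to_fract p"
proof (induction p)
  case (pCons a p)
  then show ?case
    by (simp add: peval_def map_poly_pCons to_fract_pCons qvar_def)
qed simp

text \<open>The coefficients are reversed with respect to \<open>n\<close> instead of
  \<open>degree p\<close>, so that a numerator and a denominator can share the same
  \<open>n\<close>.\<close>

lemma peval_inverse_qvar:
  assumes "degree p \<le> n"
  shows "\<exists>p'. qvar ^ n * peval (1 / qvar) p = to_fract p' \<and> degree p' \<le> n \<and> coeff p' n = coeff p 0"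
proof -
  let ?p' = "\<Sum>i\<le>n. monom (coeff p i) (n - i)"
  have "qvar ^ n * peval (1 / qvar) p = (\<Sum>i\<le>n. const_fract (coeff p i) * qvar ^ (n - i))"
  proof -
    have "p = (\<Sum>i\<le>n. monom (coeff p i) i)"
      using poly_as_sum_of_monoms'[OF assms] by simp
    moreover have "peval t (\<Sum>i\<in>A. g i) = (\<Sum>i\<in>A. peval t (g i))" for t and g :: "nat \<Rightarrow> rat poly" and A
      by (induction A rule: infinite_finite_induct) simp_all
    ultimately have "peval (1 / qvar) p = (\<Sum>i\<le>n. const_fract (coeff p i) * (1 / qvar) ^ i)"
      by (metis (no_types, lifting) peval_simps(5) sum.cong)
    then show ?thesis
      by (auto simp: sum_distrib_left power_diff power_one_over intro!: sum.cong)
  qed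
  also have "\<dots> = to_fract ?p'"
    by (intro trans[OF _ to_fract_sum[symmetric]] sum.cong)
      (simp_all add: const_fract_def qvar_power smult_monom flip: to_fract_mult)
  finally have "qvar ^ n * peval (1 / qvar) p = to_fract ?p'" .
  moreover have "degree ?p' \<le> n"
    by (intro degree_sum_le) (auto intro: order_trans[OF degree_monom_le])
  moreover have "coeff ?p' n = coeff p 0"
  proof -
    have "coeff ?p' n = (\<Sum>i\<le>n. if i = 0 then coeff p 0 else 0)"
      unfolding coeff_sum by (intro sum.cong) auto
    then show ?thesis by simp
  qed
  ultimately show ?thesis by blast
qed

text \<open>Once the coefficients of \<open>x\<close> below i vanish, coefficient i of the product
  is that of \<open>x\<close> times the nonzero constant term of \<open>d\<close>; hence they vanish
  one after another.\<close>

lemma coeff_mult_lowest: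
  fixes x d :: "'a::idom poly"
  assumes "\<And>i. i < n \<Longrightarrow> coeff (x * d) i = 0" "coeff d 0 \<noteq> 0"
  shows "i < n \<Longrightarrow> coeff x i = 0" and "coeff (x * d) n = coeff x n * coeff d 0"
proof -
  have split: "coeff (x * d) i = coeff x i * coeff d 0" if "\<And>k. k < i \<Longrightarrow> coeff x k = 0" for i
    unfolding coeff_mult using that by (subst sum.remove[of _ i]) (auto intro!: sum.neutral)
  have low: "coeff x i = 0" if "i < n" for i
    using that
  proof (induction i rule: less_induct)
    case (less i)
    then have "coeff (x * d) i = coeff x i * coeff d 0" by (intro split) auto
    then show ?case using assms less by simp
  qed
  then show "i < n \<Longrightarrow> coeff x i = 0" "coeff (x * d) n = coeff x n * coeff d 0"
    using split by auto
qed

text \<open>Clearing denominators gives N d = q^a D p with d(0) = 1 and p(0) = c, so N has no terms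
  below q^a and coefficient D(0) c there. The first conclusion serves to prove that D(0) is
  nonzero.\<close>

lemma has_lead_qvar_imp:
  assumes "has_lead qvar a c e" "c \<noteq> 0" "of_int_poly_q D * e = of_int_poly_q N"
  shows "coeff D 0 = 0 \<Longrightarrow> coeff N 0 = 0"
    and "i < a \<Longrightarrow> coeff N i = 0"
    and "coeff D 0 \<noteq> 0 \<Longrightarrow> coeff N a \<noteq> 0"
proof -
  obtain p d where pd: "coeff p 0 = c" "coeff d 0 = 1" "e * to_fract d = qvar ^ a * to_fract p"
    using assms(1) unfolding has_lead_def peval_qvar by blast
  let ?D = "map_poly of_int D :: rat poly" and ?N = "map_poly of_int N :: rat poly"
  have "of_int_poly_q N * to_fract d = of_int_poly_q D * (qvar ^ a * to_fract p)"
    by (simp flip: assms(3) pd(3))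
  then have eq: "?N * d = monom 1 a * (?D * p)"
    unfolding of_int_poly_q_def qvar_power by (simp add: mult_ac flip: to_fract_mult)
  have low: "coeff (?N * d) i = 0" if "i < a" for i
    using that by (simp add: eq coeff_monom_mult)
  have top: "coeff (?N * d) a = of_int (coeff D 0) * c"
    using pd(1) by (simp add: eq coeff_monom_mult coeff_mult_0 coeff_map_poly)
  have d0: "coeff d 0 \<noteq> 0" using pd(2) by simp
  have *: "coeff N i = 0" if "i < a" for i
    using that coeff_mult_lowest(1)[of a ?N d i] low d0 by (simp add: coeff_map_poly)
  show "i < a \<Longrightarrow> coeff N i = 0" by (rule *)
  have a: "of_int (coeff N a) = of_int (coeff D 0) * c"
    using coeff_mult_lowest(2)[of a ?N d] low d0 top pd(2) by (simp add: coeff_map_poly)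
  show "coeff D 0 \<noteq> 0 \<Longrightarrow> coeff N a \<noteq> 0"
    using a assms(2) by auto
  show "coeff D 0 = 0 \<Longrightarrow> coeff N 0 = 0"
    using a assms(2) *[of 0] by (cases "a = 0") auto
qed

text \<open>After reversal the relation reads N d' = q^j D p'. Here d' has degree exactly n, as d
  has constant term 1, and p' has degree at most n, with equality if c is nonzero. Comparing degrees
  gives both claims.\<close>

lemma has_lead_inverse_qvar_imp:
  assumes "has_lead (1 / qvar) 0 c ((1 / qvar) ^ j * e)" "D \<noteq> 0"
    and "of_int_poly_q D * e = of_int_poly_q N"
  shows "degree N \<le> degree D + j" and "c \<noteq> 0 \<Longrightarrow> degree N = degree D + j"
proof -
  let ?t = "1 / qvar"
  obtain p d where pd: "coeff p 0 = c" "coeff d 0 = 1" "?t ^ j * e * peval ?t d = peval ?t p"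
    using assms(1) unfolding has_lead_def by auto
  define n where "n = max (degree p) (degree d)"
  obtain p' where p': "qvar ^ n * peval ?t p = to_fract p'" "degree p' \<le> n" "coeff p' n = c"
    using peval_inverse_qvar[of p n] pd(1) by (auto simp: n_def)
  obtain d' where d': "qvar ^ n * peval ?t d = to_fract d'" "degree d' \<le> n" "coeff d' n = 1"
    using peval_inverse_qvar[of d n] pd(2) by (auto simp: n_def)
  have deg_d': "degree d' = n" "d' \<noteq> 0"
    using d'(2,3) le_degree[of d' n] by auto
  let ?D = "map_poly of_int D :: rat poly" and ?N = "map_poly of_int N :: rat poly"
  have "e * peval ?t d = qvar ^ j * peval ?t p"
    using pd(3) by (simp add: power_one_over field_simps)
  then have "qvar ^ j * to_fract p' = e * to_fract d'"
    unfolding p'(1)[symmetric] d'(1)[symmetric] by (simp add: mult_ac)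
  then have "of_int_poly_q N * to_fract d' = of_int_poly_q D * (qvar ^ j * to_fract p')"
    by (simp flip: assms(3))
  then have eq: "?N * d' = ?D * (monom 1 j * p')"
    unfolding of_int_poly_q_def qvar_power by (simp flip: to_fract_mult)
  have [simp]: "degree ?N = degree N" "degree ?D = degree D" "?D \<noteq> 0"
    using assms(2) by (simp_all add: degree_map_poly map_poly_eq_0_iff)
  \<comment> \<open>The second conjunct guarantees that the subtraction of naturals is
    exact.\<close>
  have deg: "degree N = degree D + j + degree p' - n \<and> n \<le> degree D + j + degree p'" if "p' \<noteq> 0"
  proof -
    have "?N * d' \<noteq> 0" using eq that by simp
    then have "?N \<noteq> 0" by auto
    then have "degree N + n = degree D + (j + degree p')"
      using arg_cong[OF eq, of degree] that deg_d' by (simp add: degree_mult_eq degree_monom_eq)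
    then show ?thesis by simp
  qed
  show "degree N \<le> degree D + j"
  proof (cases "p' = 0")
    case True
    then have "?N = 0" using eq deg_d' by simp
    then have "degree ?N = 0" by simp
    then show ?thesis by simp
  qed (use deg p'(2) in auto)
  show "degree N = degree D + j" if "c \<noteq> 0"
  proof -
    have "p' \<noteq> 0" "degree p' = n" using that p'(2,3) le_degree[of p' n] by auto
    then show ?thesis using deg by simp
  qed
qed

section \<open>From supports of rows to the polygon\<close>

lemma convex_horizontal_segment:
  fixes K :: "(real \<times> real) set"
  assumes "convex K" "(x1, y) \<in> K" "(x2, y) \<in> K" "x1 \<le> x" "x \<le> x2"
  shows "(x, y) \<in> K"
proof -
  have "x \<in> closed_segment x1 x2"
    using assms(4,5) by (simp add: closed_segment_eq_real_ivl)
  then obtain u where u: "0 \<le> u" "u \<le> 1" "x = (1 - u) * x1 + u * x2"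
    by (auto simp: closed_segment_def)
  have "(1 - u) *\<^sub>R (x1, y) + u *\<^sub>R (x2, y) \<in> K"
    using assms(1-3) u by (intro convexD_alt)
  also have "(1 - u) *\<^sub>R (x1, y) + u *\<^sub>R (x2, y) = (x, y)"
    using u(3) by (simp add: algebra_simps)
  finally show ?thesis .
qed

text \<open>Let d be the degree of the x-free coefficient. In row j the support lies between the
  left vertex (a_1 + ... + a_j, j) and the edge from (d, 0) to (d + m, m), which crosses the row at
  d + j. All listed vertices are in the support, so h = d + m.\<close>

lemma newton_eq_newton_C:
  assumes m: "length as = m" "m \<ge> 1" and deg: "degree N \<le> m"
    and low: "\<And>i j. j \<le> m \<Longrightarrow> i < sum_list (take j as) \<Longrightarrow> coeff (coeff N j) i = 0"
    and vert: "\<And>j. j \<le> m \<Longrightarrow> coeff (coeff N j) (sum_list (take j as)) \<noteq> 0"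
    and up: "\<And>j. degree (coeff N j) \<le> degree (coeff N 0) + j"
    and top: "degree (coeff N m) = degree (coeff N 0) + m"
  shows "newton N = newton_C as (int (degree (coeff N 0) + m))"
proof
  let ?d = "degree (coeff N 0)"
  let ?S = "{(real i, real j) | i j. coeff (coeff N j) i \<noteq> 0}"
  let ?C = "{(0, 0)} \<union> {(real (sum_list (take i as)), real i) | i. 1 \<le> i \<and> i \<le> length as}
     \<union> {(real (?d + m), real m), (real ?d, 0)}"
  have C: "newton_C as (int (?d + m)) = convex hull ?C"
    by (simp add: newton_C_def m(1))
  have nz: "coeff N j \<noteq> 0" if "j \<le> m" for j
    using vert[OF that] by auto
  have "?C \<subseteq> ?S"
  proof -
    have "(0, 0) \<in> ?S" using vert[of 0] by force
    moreover have "(real (sum_list (take i as)), real i) \<in> ?S" if "i \<le> length as" for i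
      using vert[of i] that m(1) by auto
    moreover have "(real (?d + m), real m) \<in> ?S"
      using nz[of m] leading_coeff_0_iff[of "coeff N m"] unfolding top by blast
    moreover have "(real ?d, real 0) \<in> ?S"
      using nz[of 0] leading_coeff_0_iff[of "coeff N 0"] by blast
    ultimately show ?thesis by auto
  qed
  then show "newton_C as (int (?d + m)) \<subseteq> newton N"
    unfolding C newton_def by (rule hull_mono)
  have "?S \<subseteq> convex hull ?C"
  proof clarify
    fix i j assume nz: "coeff (coeff N j) i \<noteq> 0"
    then have "coeff N j \<noteq> 0" by auto
    then have j: "j \<le> m" using deg le_degree[of N j] by auto
    have i: "sum_list (take j as) \<le> i" "i \<le> ?d + j"
      using low[OF j, of i] nz up[of j] le_degree[OF nz] by (auto simp: not_less[symmetric])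
    have left: "(real (sum_list (take j as)), real j) \<in> convex hull ?C"
    proof (rule hull_inc)
      show "(real (sum_list (take j as)), real j) \<in> ?C"
        using j m(1) by (cases "j = 0") auto
    qed
    have ends: "(real ?d, 0) \<in> convex hull ?C" "(real (?d + m), real m) \<in> convex hull ?C"
      by (rule hull_inc, simp)+
    \<comment> \<open>The weight j/m selects the point of the right edge at height j.\<close>
    have "(1 - real j / real m) *\<^sub>R (real ?d, 0) + (real j / real m) *\<^sub>R (real (?d + m), real m) \<in> convex hull ?C"
      using j m(2) by (intro convexD_alt convex_convex_hull ends) simp_all
    also have "(1 - real j / real m) *\<^sub>R (real ?d, 0) + (real j / real m) *\<^sub>R (real (?d + m), real m)
        = (real (?d + j), real j)"
      using m(2) by (simp add: field_simps)
    finally have right: "(real (?d + j), real j) \<in> convex hull ?C" .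
    show "(real i, real j) \<in> convex hull ?C"
      using convex_horizontal_segment[OF convex_convex_hull left right] i by simp
  qed
  then show "newton N \<subseteq> newton_C as (int (?d + m))"
    unfolding C newton_def by (rule hull_minimal) (rule convex_convex_hull)
qed

theorem mainTheorem1:
  fixes m :: nat and r :: "(nat \<times> nat) set" and as :: "nat list"
  assumes "m \<ge> 1"
    and "partial_order_on {1..m} r"
    and "sorted as"
    and "mset as = image_mset (mc_from r) (mset_set {1..m})"
  shows "\<exists>h::int. h \<ge> int (sum_list as) \<and>
           newton (numerator (q_ehrhart m r)) = newton_C as h"
proof -
  let ?V = "{1..m}" and ?E = "ehrhart_poly r {1..m}"
  have r: "r \<subseteq> ?V \<times> ?V" using partial_order_onD(4)[OF assms(2)] .
  have as: "mset as = image_mset (mc_in r ?V) (mset_set ?V)"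
    using assms(4) ext[of "mc_from r" "mc_in r ?V", OF mc_from_eq_mc_in[OF r]] by simp
  have len: "length as = m" using arg_cong[OF assms(4), of size] by simp
  have E0: "coeff ?E 0 = 1" by (simp add: coeff_ehrhart_poly_0)
  then obtain D where D: "D \<noteq> 0"
    "smult (of_int_poly_q D) ?E = map_poly of_int_poly_q (numerator ?E)" "gcd (numerator ?E) [:D:] = 1"
    using numerator_properties[of ?E] by fastforce
  define N where "N = numerator ?E"
  have cN: "of_int_poly_q D * coeff ?E j = of_int_poly_q (coeff N j)" for j
    using arg_cong[OF D(2), of "\<lambda>p. coeff p j"] by (simp add: coeff_map_poly N_def)
  have N0: "coeff N 0 = D" using cN[of 0] E0 by simp
  have degN: "degree N \<le> m"
  proof (rule degree_le, intro allI impI)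
    fix j assume "m < j"
    then have "coeff ?E j = 0" using degree_ehrhart_poly[of r ?V] by (intro coeff_eq_0) simp
    then show "coeff N j = 0" using cN[of j] by simp
  qed
  have lead: "\<exists>c\<noteq>0. has_lead qvar (sum_list (take j as)) c (coeff ?E j)" if "j \<le> m" for j
    using has_lead_coeff_ehrhart_poly[OF _ assms(2) _ assms(3) as, of j] that by simp
  have D0: "coeff D 0 \<noteq> 0"
  proof
    assume "coeff D 0 = 0"
    have "coeff (coeff N j) 0 = 0" for j
    proof (cases "j \<le> m")
      case True
      then show ?thesis
        using lead[OF True] has_lead_qvar_imp(1)[OF _ _ cN[of j]] \<open>coeff D 0 = 0\<close> by blast
    next
      case False
      then show ?thesis using degN by (simp add: coeff_eq_0)
    qed
    \<comment> \<open>\<open>[:monom 1 1:]\<close> is the variable q in \<int>[q,x], now a common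
      factor of numerator and denominator.\<close>
    then have "[:monom 1 1:] dvd N" "[:monom 1 1:] dvd [:D:]"
      using \<open>coeff D 0 = 0\<close> by (simp_all add: const_poly_dvd_iff monom_1_dvd_iff' coeff_pCons split: nat.split)
    then have "[:monom 1 1:] dvd (1 :: int poly poly)"
      using D(3) gcd_greatest by (metis N_def)
    then show False
      by (simp add: is_unit_const_poly_iff is_unit_monom_0 monom_altdef is_unit_poly_iff)
  qed
  have inv: "\<exists>c. has_lead (1 / qvar) 0 c ((1 / qvar) ^ j * coeff ?E j)" for j
    by (rule has_lead_inverse_coeff_ehrhart_poly(1)) simp
  have top: "degree (coeff N m) = degree (coeff N 0) + m"
    using has_lead_inverse_qvar_imp(2)[OF _ D(1) cN] has_lead_inverse_coeff_ehrhart_poly(2)[of ?V r]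
    unfolding N0 by simp
  have vert: "coeff (coeff N j) (sum_list (take j as)) \<noteq> 0" if "j \<le> m" for j
    using lead[OF that] has_lead_qvar_imp(3)[OF _ _ cN[of j] D0] by blast
  have "newton N = newton_C as (int (degree (coeff N 0) + m))"
  proof (rule newton_eq_newton_C[OF len assms(1) degN _ vert _ top])
    show "coeff (coeff N j) i = 0" if "j \<le> m" "i < sum_list (take j as)" for i j
      using lead[OF that(1)] has_lead_qvar_imp(2)[OF _ _ cN[of j] that(2)] by blast
    show "degree (coeff N j) \<le> degree (coeff N 0) + j" for j
      using inv[of j] has_lead_inverse_qvar_imp(1)[OF _ D(1) cN[of j]] unfolding N0 by blast
  qed
  \<comment> \<open>The left vertex of row m is in the support, so its exponent of q is at most the
    degree of that row.\<close>
  moreover have "sum_list as \<le> degree (coeff N 0) + m"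
    using le_degree[OF vert[of m]] top len by simp
  ultimately show ?thesis
    unfolding q_ehrhart_eq[OF r] N_def by (intro exI[of _ "int (degree (coeff (numerator ?E) 0) + m)"]) simp
qed

end
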